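(* For positive integers $\ell,m$, let $\lambda_{\ell,m}\in\mathrm{NC}(\ell m)$ be the interval partition consisting of $m$ blocks of size $\ell$ each: $$\lambda_{\ell,m}=\bigl\{\{1,\ldots,\ell\},\{\ell+1,\ldots,2\ell\},\ldots,\{(m-1)\ell+1,\ldots,m\ell\}\bigr\}.$$ Then the number of meandric partners of $\lambda_{\ell,m}$, that is, the number of $\rho\in\mathrm{NC}(\ell m)$ with $d_H(\lambda_{\ell,m},\rho)=\ell m-1$, is equal to $\mathrm{FCat}_m^{(\ell)}\cdot\ell^{m-1}$, where $$\mathrm{FCat}_m^{(\ell)}:=\frac{1}{(\ell-1)m+1}\binom{\ell m}{m}.$$
   Context: For a positive integer $n$, a partition $\pi$ of $\{1,\ldots,n\}$ is non-crossing if there are no two distinct blocks $V,W$ of $\pi$ and numbers $a<b<c<d$ with $a,c\in V$ and $b,d\in W$. $\mathrm{NC}(n)$ is the set of non-crossing partitions of $\{1,\ldots,n\}$, partially ordered by $\pi\le\rho$ iff every block of $\pi$ is contained in a block of $\rho$. The Hasse diagram $\mathcal{H}_n$ is the undirected graph with vertex set $\mathrm{NC}(n)$ in which $\pi_1,\pi_2$ are joined by an edge iff one of them covers the other in $(\mathrm{NC}(n),\le)$; $d_H(\pi,\rho)$ is the graph distance in $\mathcal{H}_n$. *)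

theory Defs
  imports
    Complex_Main
    "HOL-Library.Disjoint_Sets"
    "Graph_Theory.Pair_Digraph"
    "Graph_Theory.Shortest_Path"
begin

definition noncrossing :: "nat set set \<Rightarrow> bool" where
  "noncrossing \<pi> \<longleftrightarrow>
     \<not> (\<exists>V\<in>\<pi>. \<exists>W\<in>\<pi>. V \<noteq> W \<and>
         (\<exists>a b c d. a < b \<and> b < c \<and> c < d \<and> a \<in> V \<and> c \<in> V \<and> b \<in> W \<and> d \<in> W))"

definition NC :: "nat \<Rightarrow> nat set set set" where
  "NC n = {\<pi>. partition_on {1..n} \<pi> \<and> noncrossing \<pi>}"

text \<open>The covering relation is relative to the poset \<open>NC n\<close>: the intermediate element
  \<open>\<sigma>\<close> ranges over non-crossing partitions only. The order is \<^const>\<open>refines\<close>.\<close>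

definition NC_covers :: "nat \<Rightarrow> nat set set \<Rightarrow> nat set set \<Rightarrow> bool" where
  "NC_covers n \<rho> \<pi> \<longleftrightarrow>
     \<pi> \<in> NC n \<and> \<rho> \<in> NC n \<and> refines {1..n} \<pi> \<rho> \<and> \<pi> \<noteq> \<rho> \<and>
     \<not> (\<exists>\<sigma>\<in>NC n. \<sigma> \<noteq> \<pi> \<and> \<sigma> \<noteq> \<rho> \<and> refines {1..n} \<pi> \<sigma> \<and> refines {1..n} \<sigma> \<rho>)"

text \<open>An undirected edge is represented by the two opposite arcs; see
  \<open>pair_graph_hasse_diagram\<close> below.\<close>

definition hasse_diagram :: "nat \<Rightarrow> nat set set pair_pre_digraph" where
  "hasse_diagram n =
     \<lparr> pverts = NC n,
       parcs = {(\<pi>\<^sub>1, \<pi>\<^sub>2). NC_covers n \<pi>\<^sub>1 \<pi>\<^sub>2 \<or> NC_covers n \<pi>\<^sub>2 \<pi>\<^sub>1} \<rparr>"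

text \<open>Graph distance is the shortest-path cost with all arcs of weight 1. It is extended-real
  valued, with value \<open>\<infinity>\<close> if there is no walk.\<close>

definition hasse_dist :: "nat \<Rightarrow> nat set set \<Rightarrow> nat set set \<Rightarrow> ereal" where
  "hasse_dist n \<pi> \<rho> = wf_digraph.\<mu> (with_proj (hasse_diagram n)) (\<lambda>_. 1) \<pi> \<rho>"

definition meandric_partners :: "nat \<Rightarrow> nat set set \<Rightarrow> nat set set set" where
  "meandric_partners n \<pi> = {\<rho> \<in> NC n. hasse_dist n \<pi> \<rho> = ereal (real n - 1)}"

definition interval_partition :: "nat \<Rightarrow> nat \<Rightarrow> nat set set" where
  "interval_partition l m = (\<lambda>j. {j * l + 1..(j + 1) * l}) ` {0..<m}"

definition FCat :: "nat \<Rightarrow> nat \<Rightarrow> real" where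
  "FCat l m = 1 / ((real l - 1) * real m + 1) * real ((l * m) choose m)"

lemma finite_NC: "finite (NC n)"
proof (rule finite_subset)
  show "NC n \<subseteq> Pow (Pow {1..n})"
    by (auto simp: NC_def partition_on_def)
qed simp

lemma pair_graph_hasse_diagram: "pair_graph (hasse_diagram n)"
proof -
  have "parcs (hasse_diagram n) \<subseteq> NC n \<times> NC n"
    by (auto simp: hasse_diagram_def NC_covers_def)
  moreover from this have "finite (parcs (hasse_diagram n))"
    using finite_NC finite_subset by blast
  ultimately show ?thesis
    by unfold_locales
      (auto simp: hasse_diagram_def finite_NC symmetric_def sym_def NC_covers_def)
qed

lemma hasse_dist_eq_INF:
  "hasse_dist n \<pi> \<rho> =
     (INF p \<in> {p. pre_digraph.awalk (with_proj (hasse_diagram n)) \<pi> p \<rho>}. ereal (real (length p)))"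
proof -
  interpret pair_graph "hasse_diagram n"
    by (rule pair_graph_hasse_diagram)
  have "awalk_cost (\<lambda>_. 1) p = real (length p)" for p :: "(nat set set \<times> nat set set) list"
    by (induction p) simp_all
  then show ?thesis
    unfolding hasse_dist_def \<mu>_def by simp
qed

lemma interval_partition_in_NC:
  assumes "l \<ge> 1"
  shows "interval_partition l m \<in> NC (l * m)"
proof -
  let ?B = "\<lambda>j. {j * l + 1..(j + 1) * l}"
  have sep: "x < y" if "x \<in> ?B i" "y \<in> ?B j" "i < j" for i j x y
  proof -
    have "(i + 1) * l \<le> j * l" using that(3) by (intro mult_le_mono1) simp
    with that show ?thesis by (simp del: add_mult_distrib)
  qed
  have un: "(\<Union>j<m. ?B j) = {1..l * m}" 
  proof (induction m)
    case (Suc m)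
    have "(\<Union>j<Suc m. ?B j) = ?B m \<union> {1..l * m}"
      unfolding lessThan_Suc UN_insert Suc.IH ..
    also have "... = {1..l * Suc m}"
      unfolding mult.commute[of l] Suc_eq_plus1 by auto
    finally show ?case .
  qed simp
  have disj: "?B i \<inter> ?B j = {}" if "i \<noteq> j" for i j
  proof (rule ccontr)
    assume "?B i \<inter> ?B j \<noteq> {}"
    then obtain x where "x \<in> ?B i" "x \<in> ?B j" by blast
    moreover from that consider "i < j" | "j < i" by linarith
    ultimately show False
      using sep[of x i x j] sep[of x j x i] by cases blast+
  qed
  have "partition_on {1..l * m} (interval_partition l m)"
  proof (rule partition_onI)
    show "\<Union> (interval_partition l m) = {1..l * m}"
      using un by (simp add: interval_partition_def lessThan_atLeast0)
    show "disjnt p q" if "p \<in> interval_partition l m" "q \<in> interval_partition l m" "p \<noteq> q" for p q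
    proof -
      from that obtain i j where ij: "p = ?B i" "q = ?B j"
        unfolding interval_partition_def by (elim imageE)
      with that have "i \<noteq> j" by metis
      then show ?thesis unfolding ij disjnt_def by (rule disj)
    qed
    show "{} \<notin> interval_partition l m"
      using assms by (auto simp: interval_partition_def)
  qed
  moreover have "noncrossing (interval_partition l m)"
    unfolding noncrossing_def
  proof (intro notI, elim bexE conjE exE)
    fix V W a b c d
    assume "V \<in> interval_partition l m" "W \<in> interval_partition l m" "V \<noteq> W"
      and h: "a < b" "b < c" "a \<in> V" "c \<in> V" "b \<in> W"
    then obtain i j where ij: "V = ?B i" "W = ?B j"
      unfolding interval_partition_def by (elim imageE)
    with \<open>V \<noteq> W\<close> have "i \<noteq> j" by metis
    then consider "i < j" | "j < i" by linarith
    then show False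
    proof cases
      case 1
      then show False using sep[of c i b j] h unfolding ij by (meson less_asym)
    next
      case 2
      then show False using sep[of b j a i] h unfolding ij by (meson less_asym)
    qed
  qed
  ultimately show ?thesis by (simp add: NC_def)
qed

end

theory Submission
  imports Defs
begin

text \<open>
  If \<open>\<tau>\<close> is a common coarsening of \<open>\<pi>\<close> and \<open>\<rho>\<close> in \<open>NC n\<close>, then going up to \<open>\<tau>\<close> and down again gives
  \<open>d(\<pi>, \<rho>) \<le> |\<pi>| + |\<rho>| - 2 |\<tau>|\<close>; conversely, collecting the mergers along a walk of length \<open>k\<close> yields a
  common coarsening (crossing or not) with \<open>k \<ge> |\<pi>| + |\<rho>| - 2 |\<tau>|\<close>. When \<open>\<pi>\<close> is the interval partition,
  this makes \<open>\<rho>\<close> a meandric partner iff the bipartite graph on the blocks of \<open>\<pi>\<close> and \<open>\<rho>\<close>, with one edge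
  per point, is a tree. Such trees with a first interval of \<open>k\<close> points and \<open>M\<close> further intervals of \<open>l\<close>
  points are counted by looking at the last point \<open>x\<close> of the first interval: either \<open>x\<close> is a singleton
  block of \<open>\<rho>\<close>, or, \<open>b\<close> being the next element of its block, the tree splits into its part strictly
  between \<open>x\<close> and \<open>b\<close> and the rest, where the intervals of \<open>x\<close> and \<open>b\<close> get merged. The counts are therefore the
  coefficients of \<open>S\<^sup>k\<close> where \<open>S = 1 + l z S\<^sup>l\<close>.
\<close>

subsection \<open>Non-crossing partitions forming a tree\<close>

text \<open>The two distance estimates do not match as they stand: going up requires a coarsening
  inside \<open>NC n\<close>, whereas a walk only produces a coarsening that may cross. For interval
  partitions the gap closes because labels are monotone along the points: if the graph is
  disconnected, some nonempty union of components is a set of consecutive points missing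
  \<open>1\<close> (\<open>stable_interval\<close>), and this set and its complement form a
  non-crossing common coarsening with two blocks. The size \<open>k\<close> of the first interval
  has to vary independently of \<open>l\<close>, since cutting at \<open>b\<close> leaves a
  truncated interval on one side and an enlarged one on the other. If \<open>b\<close> is preceded
  by \<open>s\<close> points of its own interval, the two sides have first intervals of
  \<open>s\<close> and \<open>k + l - s\<close> points. These sizes always add up to
  \<open>k + l\<close>, so summing over the number of full intervals in between gives a coefficient
  of \<open>S^(k+l)\<close> that does not depend on \<open>s\<close>; the \<open>l\<close> values of
  \<open>s\<close> give the factor \<open>l\<close> in \<open>S^(k+1) = S^k + l z S^(k+l)\<close>.
  \<open>noncross\<close> is stated for any linear order because the counting is done on integer
  points.\<close>

definition noncross :: "'a::linorder set set \<Rightarrow> bool" where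
  "noncross \<rho> \<longleftrightarrow>
     (\<forall>V\<in>\<rho>. \<forall>W\<in>\<rho>. \<forall>a\<in>V. \<forall>b\<in>W. \<forall>c\<in>V. \<forall>d\<in>W. a < b \<longrightarrow> b < c \<longrightarrow> c < d \<longrightarrow> V = W)"

text \<open>In the bipartite graph whose edges are the points, these are the edge sets of unions of
  connected components.\<close>

definition stable :: "'a set \<Rightarrow> ('a \<Rightarrow> 'b) \<Rightarrow> 'a set set \<Rightarrow> 'a set \<Rightarrow> bool" where
  "stable X lab \<rho> A \<longleftrightarrow>
     A \<subseteq> X \<and> (\<forall>B\<in>\<rho>. B \<inter> A = {} \<or> B \<subseteq> A) \<and> (\<forall>y\<in>A. \<forall>z\<in>X. lab z = lab y \<longrightarrow> z \<in> A)"

text \<open>Connectedness without paths: every component reaches the root. It holds vacuously for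
  empty \<open>X\<close>, where the root is the whole graph.\<close>

definition rooted :: "'a set \<Rightarrow> ('a \<Rightarrow> 'b) \<Rightarrow> 'b \<Rightarrow> 'a set set \<Rightarrow> bool" where
  "rooted X lab r \<rho> \<longleftrightarrow> (\<forall>A. stable X lab \<rho> A \<longrightarrow> A \<noteq> {} \<longrightarrow> r \<in> lab ` A)"

text \<open>Vertices of the tree: the label classes of \<open>X\<close> and the blocks of \<open>\<rho>\<close>; edges: the points of \<open>X\<close>.
  The root label \<open>r\<close> counts as a vertex even if no point carries it.\<close>

definition ptrees :: "'a::linorder set \<Rightarrow> ('a \<Rightarrow> 'b) \<Rightarrow> 'b \<Rightarrow> 'a set set set" where
  "ptrees X lab r =
     {\<rho>. partition_on X \<rho> \<and> noncross \<rho> \<and> rooted X lab r \<rho> \<and>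
          card (insert r (lab ` X)) + card \<rho> = card X + 1}"

section \<open>Stable sets, partitions and the vertex count\<close>

lemma stableI:
  assumes "A \<subseteq> X" "\<And>B y z. \<lbrakk>B \<in> \<rho>; y \<in> B; z \<in> B; y \<in> A\<rbrakk> \<Longrightarrow> z \<in> A"
    "\<And>y z. \<lbrakk>y \<in> A; z \<in> X; lab z = lab y\<rbrakk> \<Longrightarrow> z \<in> A"
  shows "stable X lab \<rho> A"
  unfolding stable_def using assms(1) assms(2) assms(3) by (intro conjI ballI impI; blast)

lemma stable_subset: "stable X lab \<rho> A \<Longrightarrow> A \<subseteq> X"
  by (simp add: stable_def)

lemma stable_block: "\<lbrakk>stable X lab \<rho> A; B \<in> \<rho>; y \<in> B; y \<in> A; z \<in> B\<rbrakk> \<Longrightarrow> z \<in> A"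
  unfolding stable_def by blast

lemma stable_lab: "\<lbrakk>stable X lab \<rho> A; y \<in> A; z \<in> X; lab z = lab y\<rbrakk> \<Longrightarrow> z \<in> A"
  by (simp add: stable_def)

lemma rootedD: "\<lbrakk>rooted X lab r \<rho>; stable X lab \<rho> A; A \<noteq> {}\<rbrakk> \<Longrightarrow> \<exists>y\<in>A. lab y = r"
  unfolding rooted_def by blast

lemma partition_on_same_block:
  "\<lbrakk>partition_on X \<rho>; B \<in> \<rho>; C \<in> \<rho>; x \<in> B; x \<in> C\<rbrakk> \<Longrightarrow> B = C"
  by (auto simp: partition_on_def pairwise_def disjnt_def)

lemma partition_on_block_ex:
  assumes "partition_on X \<rho>" "x \<in> X"
  obtains B where "B \<in> \<rho>" "x \<in> B"
  using assms by (auto simp: partition_on_def)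

lemma partition_on_block_subset: "\<lbrakk>partition_on X \<rho>; B \<in> \<rho>\<rbrakk> \<Longrightarrow> B \<subseteq> X"
  by (auto simp: partition_on_def)

lemma partition_on_Diff_singleton:
  assumes "partition_on X \<rho>" "{x} \<in> \<rho>"
  shows "partition_on (X - {x}) (\<rho> - {{x}})"
proof (rule partition_onI)
  have "B = {x}" if "B \<in> \<rho>" "x \<in> B" for B
    using partition_on_same_block[OF assms(1) that(1) assms(2) that(2)] by simp
  then show "\<Union> (\<rho> - {{x}}) = X - {x}"
    unfolding partition_onD1[OF assms(1)] by blast
  show "disjnt p q" if "p \<in> \<rho> - {{x}}" "q \<in> \<rho> - {{x}}" "p \<noteq> q" for p q
    using that partition_onD2[OF assms(1)] by (auto simp: disjoint_def disjnt_def)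
  show "{} \<notin> \<rho> - {{x}}" using partition_onD3[OF assms(1)] by blast
qed

lemma noncrossD:
  "\<lbrakk>noncross \<rho>; V \<in> \<rho>; W \<in> \<rho>; a \<in> V; b \<in> W; c \<in> V; d \<in> W; a < b; b < c; c < d\<rbrakk> \<Longrightarrow> V = W"
  unfolding noncross_def by blast

lemma noncross_subset: "\<lbrakk>noncross \<rho>; \<sigma> \<subseteq> \<rho>\<rbrakk> \<Longrightarrow> noncross \<sigma>"
  unfolding noncross_def by blast

lemma finite_ptrees: "finite X \<Longrightarrow> finite (ptrees X lab r)"
  by (rule finite_subset[OF _ finitely_many_partition_on[of X]]) (auto simp: ptrees_def)

text \<open>A connected graph has at most one vertex more than it has edges. Take a maximal
  \<open>A\<close> satisfying this bound for the vertices it touches, the root included. A further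
  point meeting one of these vertices could be added at the cost of at most one new vertex, so there
  is none. Then \<open>X - A\<close> is stable and misses the root, hence is empty.\<close>

lemma rooted_card_le:
  assumes fin: "finite X" and part: "partition_on X \<rho>" and root: "rooted X lab r \<rho>"
  shows "card (insert r (lab ` X)) + card \<rho> \<le> card X + 1"
proof -
  have finp: "finite \<rho>" using fin part by (rule finite_elements)
  define P where "P A \<longleftrightarrow>
    A \<subseteq> X \<and> card (insert r (lab ` A)) + card {B\<in>\<rho>. B \<inter> A \<noteq> {}} \<le> card A + 1" for A
  have "finite {A. P A}"
    by (rule finite_subset[of _ "Pow X"]) (auto simp: P_def fin)
  moreover have "{} \<in> {A. P A}" by (simp add: P_def)
  ultimately obtain A where "P A" and max: "\<And>A'. P A' \<Longrightarrow> A \<subseteq> A' \<Longrightarrow> A' = A"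
    using finite_has_maximal[of "{A. P A}"] by (metis empty_iff mem_Collect_eq)
  have AX: "A \<subseteq> X" and finA: "finite A" using \<open>P A\<close> fin finite_subset by (auto simp: P_def)
  have ext: "\<not> (lab y \<in> insert r (lab ` A) \<or> (\<exists>B\<in>\<rho>. y \<in> B \<and> B \<inter> A \<noteq> {}))" if y: "y \<in> X - A" for y
  proof
    assume H: "lab y \<in> insert r (lab ` A) \<or> (\<exists>B\<in>\<rho>. y \<in> B \<and> B \<inter> A \<noteq> {})"
    obtain C where C: "C \<in> \<rho>" "y \<in> C" using part y by (meson DiffD1 partition_on_block_ex)
    have eqC: "B = C" if "B \<in> \<rho>" "y \<in> B" for B
      using partition_on_same_block[OF part that(1) C(1) that(2) C(2)] .
    have blocks: "{B\<in>\<rho>. B \<inter> insert y A \<noteq> {}} = insert C {B\<in>\<rho>. B \<inter> A \<noteq> {}}"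
      using C eqC by blast
    have labs: "insert r (lab ` insert y A) = insert (lab y) (insert r (lab ` A))" by auto
    have "card (insert r (lab ` insert y A)) + card {B\<in>\<rho>. B \<inter> insert y A \<noteq> {}} \<le>
      Suc (card (insert r (lab ` A)) + card {B\<in>\<rho>. B \<inter> A \<noteq> {}})"
    proof (cases "lab y \<in> insert r (lab ` A)")
      case True
      then show ?thesis unfolding labs blocks using finp
        by (simp add: insert_absorb card_insert_if)
    next
      case False
      with H have "C \<in> {B\<in>\<rho>. B \<inter> A \<noteq> {}}"
        using C eqC by blast
      then have "insert C {B\<in>\<rho>. B \<inter> A \<noteq> {}} = {B\<in>\<rho>. B \<inter> A \<noteq> {}}" by blast
      then show ?thesis unfolding labs blocks using finA by (simp add: card_insert_if)
    qed
    then have "P (insert y A)" using \<open>P A\<close> y finA by (auto simp: P_def)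
    then show False using max[of "insert y A"] y by blast
  qed
  have "A = X"
  proof (rule ccontr)
    assume "A \<noteq> X"
    have "stable X lab \<rho> (X - A)"
      unfolding stable_def
    proof (intro conjI ballI impI)
      fix B assume B: "B \<in> \<rho>"
      show "B \<inter> (X - A) = {} \<or> B \<subseteq> X - A"
        using ext B partition_on_block_subset[OF part B] by blast
    next
      fix y z assume "y \<in> X - A" "z \<in> X" "lab z = lab y"
      then show "z \<in> X - A" using ext[of y] by (metis DiffI imageI insertI2)
    qed auto
    then have "r \<in> lab ` (X - A)"
      using root \<open>A \<noteq> X\<close> AX by (auto simp: rooted_def)
    then show False using ext by blast
  qed
  moreover have "{B\<in>\<rho>. B \<inter> X \<noteq> {}} = \<rho>"
    using partition_on_block_subset[OF part] partition_onD3[OF part] by (auto simp: Int_absorb2)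
  ultimately show ?thesis using \<open>P A\<close> by (simp add: P_def)
qed

lemma ptrees_empty: "ptrees {} lab r = {{}}"
  by (auto simp: ptrees_def partition_on_empty noncross_def rooted_def stable_def)

lemma ptrees_no_root: "\<lbrakk>X \<noteq> {}; r \<notin> lab ` X\<rbrakk> \<Longrightarrow> ptrees X lab r = {}"
  by (auto simp: ptrees_def rooted_def stable_def partition_on_def)

text \<open>Two such points would be parallel edges. Deleting one leaves the graph connected on the
  same vertices, and \<open>rooted_card_le\<close> for the smaller point set contradicts the vertex
  count of a tree.\<close>

lemma ptrees_no_double_edge:
  assumes fin: "finite X" and \<rho>: "\<rho> \<in> ptrees X lab r"
    and B: "B \<in> \<rho>" "x \<in> B" "y \<in> B" and lab: "lab x = lab y"
  shows "x = y"
proof (rule ccontr)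
  assume neq: "x \<noteq> y"
  have part: "partition_on X \<rho>" and root: "rooted X lab r \<rho>"
    and cnt: "card (insert r (lab ` X)) + card \<rho> = card X + 1"
    using \<rho> by (auto simp: ptrees_def)
  have BX: "B \<subseteq> X" using part B partition_on_block_subset by blast
  have disj: "C \<inter> B = {}" if "C \<in> \<rho>" "C \<noteq> B" for C
    using part that B by (auto simp: partition_on_def pairwise_def disjnt_def)
  have pd: "C \<inter> D = {}" if "C \<in> \<rho>" "D \<in> \<rho>" "C \<noteq> D" for C D
    using part that by (auto simp: partition_on_def pairwise_def disjnt_def)
  let ?\<sigma> = "insert (B - {x}) (\<rho> - {B})"
  have "partition_on (X - {x}) ?\<sigma>"
  proof (rule partition_onI)
    show "\<Union>?\<sigma> = X - {x}" using disj B part by (auto simp: partition_on_def)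
    show "disjnt p q" if "p \<in> ?\<sigma>" "q \<in> ?\<sigma>" "p \<noteq> q" for p q
      using that disj pd unfolding disjnt_def by blast
    show "{} \<notin> ?\<sigma>" using B neq part by (auto simp: partition_on_def)
  qed
  moreover have "rooted (X - {x}) lab r ?\<sigma>"
    unfolding rooted_def
  proof (intro allI impI)
    fix A assume A: "stable (X - {x}) lab ?\<sigma> A" "A \<noteq> {}"
    show "r \<in> lab ` A"
    \<comment> \<open>If \<open>y\<close> is in \<open>A\<close>, then \<open>x\<close> must be
      added to get a set stable for \<open>\<rho>\<close>, but this brings no new label. Otherwise
      \<open>A\<close> is already stable.\<close>
    proof (cases "y \<in> A")
      case True
      have "stable X lab \<rho> (insert x A)"
      proof (rule stableI)
        show "insert x A \<subseteq> X" using stable_subset[OF A(1)] B BX by blast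
      next
        fix C u v assume C: "C \<in> \<rho>" "u \<in> C" "v \<in> C" "u \<in> insert x A"
        show "v \<in> insert x A"
        proof (cases "C = B")
          case True
          then show ?thesis
            using stable_block[OF A(1), of "B - {x}" y v] \<open>y \<in> A\<close> B(3) C(3) neq by blast
        next
          case False
          then have "u \<noteq> x" using disj[OF C(1)] B C by blast
          then show ?thesis using stable_block[OF A(1), of C u v] C False by blast
        qed
      next
        fix u v assume uv: "u \<in> insert x A" "v \<in> X" "lab v = lab u"
        then obtain w where "w \<in> A" "lab v = lab w" using True lab by auto
        then show "v \<in> insert x A" using stable_lab[OF A(1)] uv(2) by blast
      qed
      from rootedD[OF root this] obtain z where "z \<in> insert x A" "lab z = r" by blast
      then show ?thesis using True lab by auto
    next
      case False
      have "stable X lab \<rho> A"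
      proof (rule stableI)
        show "A \<subseteq> X" using stable_subset[OF A(1)] by blast
      next
        fix C u v assume C: "C \<in> \<rho>" "u \<in> C" "v \<in> C" "u \<in> A"
        have "u \<noteq> x" using stable_subset[OF A(1)] C by blast
        then have "C \<noteq> B" using stable_block[OF A(1), of "B - {x}" u y] C B neq False by blast
        then show "v \<in> A" using stable_block[OF A(1), of C u v] C by blast
      next
        fix u v assume uv: "u \<in> A" "v \<in> X" "lab v = lab u"
        have "v \<noteq> x" using stable_lab[OF A(1) uv(1), of y] B BX neq lab uv(3) False by auto
        then show "v \<in> A" using stable_lab[OF A(1) uv(1), of v] uv by blast
      qed
      from rootedD[OF root this A(2)] show ?thesis by blast
    qed
  qed
  ultimately have "card (insert r (lab ` (X - {x}))) + card ?\<sigma> \<le> card (X - {x}) + 1"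
    using fin by (intro rooted_card_le) auto
  moreover have "lab ` (X - {x}) = lab ` X"
    using B BX neq lab by (auto simp: image_iff)
  moreover have "card ?\<sigma> = card \<rho>"
  proof -
    have "B - {x} \<notin> \<rho> - {B}" using disj B neq by blast
    moreover have "finite \<rho>" using fin part finite_elements by blast
    ultimately show ?thesis using B(1) by (metis card_Suc_Diff1 card_insert_disjoint finite_Diff)
  qed
  moreover have "card (X - {x}) < card X" using fin B BX by (meson card_Diff1_less subsetD)
  ultimately show False using cnt by simp
qed

section \<open>Transport along monotone and antitone maps\<close>

lemma card_image_eq_of_same_fibres:
  assumes "\<And>x y. x \<in> X \<Longrightarrow> y \<in> X \<Longrightarrow> u x = u y \<longleftrightarrow> v x = v y"
  shows "card (u ` X) = card (v ` X)"
proof -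
  let ?w = "\<lambda>z. v (inv_into X u z)"
  have w: "?w (u x) = v x" if "x \<in> X" for x
    using assms[of "inv_into X u (u x)" x] that by (simp add: inv_into_into f_inv_into_f)
  have "inj_on ?w (u ` X)"
  proof (rule inj_onI)
    fix z z' assume "z \<in> u ` X" "z' \<in> u ` X" "?w z = ?w z'"
    then show "z = z'" by (elim imageE) (simp add: w assms)
  qed
  moreover have "?w ` u ` X = v ` X"
    using w by (simp add: image_image cong: image_cong)
  ultimately show ?thesis by (metis card_image)
qed

text \<open>Reversing the order turns a crossing into a crossing, and the tree conditions only see
  which points share a label and which carry the root. The antitone case serves the reflection in
  \<open>card_left_part\<close>.\<close>

lemma ptrees_image:
  assumes fin: "finite X" and \<rho>: "\<rho> \<in> ptrees X lab r"
    and mono: "(\<forall>x\<in>X. \<forall>y\<in>X. x < y \<longrightarrow> f x < f y) \<or> (\<forall>x\<in>X. \<forall>y\<in>X. x < y \<longrightarrow> f y < f x)"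
    and lab: "\<And>x y. x \<in> X \<Longrightarrow> y \<in> X \<Longrightarrow> lab' (f x) = lab' (f y) \<longleftrightarrow> lab x = lab y"
    and rt: "\<And>x. x \<in> X \<Longrightarrow> lab' (f x) = r' \<longleftrightarrow> lab x = r"
  shows "(`) f ` \<rho> \<in> ptrees (f ` X) lab' r'"
proof -
  have inj: "inj_on f X"
    using mono by (auto simp: inj_on_def) (metis linorder_neqE order_less_irrefl)+
  have part: "partition_on X \<rho>" and nc: "noncross \<rho>" and root: "rooted X lab r \<rho>"
    and cnt: "card (insert r (lab ` X)) + card \<rho> = card X + 1"
    using \<rho> by (auto simp: ptrees_def)
  have sub: "B \<subseteq> X" if "B \<in> \<rho>" for B using part that partition_on_block_subset by blast
  have less: "(\<forall>x\<in>X. \<forall>y\<in>X. f x < f y \<longleftrightarrow> x < y) \<or> (\<forall>x\<in>X. \<forall>y\<in>X. f x < f y \<longleftrightarrow> y < x)"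
    using mono by (metis linorder_neqE order_less_asym order_less_irrefl)
  have "partition_on (f ` X) ((`) f ` \<rho> - {{}})"
    using part inj by (rule partition_on_inj_image)
  moreover have "{} \<notin> (`) f ` \<rho>" using part by (auto simp: partition_on_def)
  ultimately have part': "partition_on (f ` X) ((`) f ` \<rho>)" by simp
  have nc': "noncross ((`) f ` \<rho>)"
    unfolding noncross_def
  proof (intro ballI impI)
    fix V' W' a' b' c' d'
    assume "V' \<in> (`) f ` \<rho>" "W' \<in> (`) f ` \<rho>" "a' \<in> V'" "b' \<in> W'" "c' \<in> V'" "d' \<in> W'"
      and ord: "a' < b'" "b' < c'" "c' < d'"
    then obtain V W a b c d where h: "V \<in> \<rho>" "W \<in> \<rho>" "V' = f ` V" "W' = f ` W"
      "a \<in> V" "b \<in> W" "c \<in> V" "d \<in> W" "a' = f a" "b' = f b" "c' = f c" "d' = f d"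
      by auto
    have X: "a \<in> X" "b \<in> X" "c \<in> X" "d \<in> X" using h sub by auto
    from less have "V = W"
    proof
      assume "\<forall>x\<in>X. \<forall>y\<in>X. f x < f y \<longleftrightarrow> x < y"
      then have "a < b" "b < c" "c < d" using h X ord by auto
      then show ?thesis using nc h by (meson noncrossD)
    next
      assume "\<forall>x\<in>X. \<forall>y\<in>X. f x < f y \<longleftrightarrow> y < x"
      then have "d < c" "c < b" "b < a" using h X ord by auto
      then show ?thesis using nc h by (metis noncrossD)
    qed
    then show "V' = W'" using h by simp
  qed
  have root': "rooted (f ` X) lab' r' ((`) f ` \<rho>)"
    unfolding rooted_def
  proof (intro allI impI)
    fix A' assume A': "stable (f ` X) lab' ((`) f ` \<rho>) A'" "A' \<noteq> {}"
    define A where "A = {x\<in>X. f x \<in> A'}"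
    have im: "A' = f ` A" using A' by (auto simp: A_def stable_def)
    have "stable X lab \<rho> A"
      unfolding stable_def
    proof (intro conjI ballI impI)
      show "A \<subseteq> X" by (auto simp: A_def)
    next
      fix B assume B: "B \<in> \<rho>"
      then have "f ` B \<inter> A' = {} \<or> f ` B \<subseteq> A'" using A'(1) by (auto simp: stable_def)
      then show "B \<inter> A = {} \<or> B \<subseteq> A" using sub[OF B] by (auto simp: A_def)
    next
      fix y z assume "y \<in> A" "z \<in> X" "lab z = lab y"
      then show "z \<in> A" using A'(1) lab by (auto simp: A_def stable_def)
    qed
    then have "r \<in> lab ` A" using root A' im by (auto simp: rooted_def)
    then obtain x where "x \<in> A" "lab x = r" by auto
    then have "lab' (f x) = r'" using rt by (auto simp: A_def)
    then show "r' \<in> lab' ` A'" using \<open>x \<in> A\<close> im by auto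
  qed
  have "card ((`) f ` \<rho>) = card \<rho>"
    using inj_on_image_Pow[OF inj] sub by (intro card_image) (auto simp: inj_on_def)
  moreover have "card (f ` X) = card X" using inj by (rule card_image)
  moreover have "card (insert r' (lab' ` f ` X)) = card (insert r (lab ` X))"
  proof -
    have "card (lab' ` f ` X) = card (lab ` X)"
      using card_image_eq_of_same_fibres[of X "\<lambda>x. lab' (f x)" lab] lab by (simp add: image_image)
    moreover have "r' \<in> lab' ` f ` X \<longleftrightarrow> r \<in> lab ` X" using rt by (auto simp: image_iff)
    ultimately show ?thesis using fin by (simp add: card_insert_if)
  qed
  ultimately show ?thesis using part' nc' root' cnt by (simp add: ptrees_def)
qed

lemma card_ptrees_image:
  assumes fin: "finite X"
    and mono: "(\<forall>x\<in>X. \<forall>y\<in>X. x < y \<longrightarrow> f x < f y) \<or> (\<forall>x\<in>X. \<forall>y\<in>X. x < y \<longrightarrow> f y < f x)"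
    and lab: "\<And>x y. x \<in> X \<Longrightarrow> y \<in> X \<Longrightarrow> lab' (f x) = lab' (f y) \<longleftrightarrow> lab x = lab y"
    and rt: "\<And>x. x \<in> X \<Longrightarrow> lab' (f x) = r' \<longleftrightarrow> lab x = r"
  shows "card (ptrees (f ` X) lab' r') = card (ptrees X lab r)"
proof -
  have inj: "inj_on f X"
    using mono by (auto simp: inj_on_def) (metis linorder_neqE order_less_irrefl)+
  let ?g = "inv_into X f"
  have g: "?g (f x) = x" if "x \<in> X" for x using inj that by simp
  have gX: "?g ` f ` X = X" using g by (auto simp: image_image)
  have monog: "(\<forall>x\<in>f ` X. \<forall>y\<in>f ` X. x < y \<longrightarrow> ?g x < ?g y) \<or>
    (\<forall>x\<in>f ` X. \<forall>y\<in>f ` X. x < y \<longrightarrow> ?g y < ?g x)"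
    using mono g by (auto; metis linorder_neqE order_less_asym order_less_irrefl)
  have "bij_betw ((`) ((`) f)) (ptrees X lab r) (ptrees (f ` X) lab' r')"
  proof (rule bij_betw_byWitness[where f' = "(`) ((`) ?g)"])
    show "\<forall>\<rho>\<in>ptrees X lab r. (`) ?g ` (`) f ` \<rho> = \<rho>"
    proof
      fix \<rho> assume "\<rho> \<in> ptrees X lab r"
      then have "(\<lambda>B. ?g ` f ` B) ` \<rho> = (\<lambda>B. B) ` \<rho>"
        by (intro image_cong refl inv_into_image_cancel[OF inj] partition_on_block_subset)
           (auto simp: ptrees_def)
      then show "(`) ?g ` (`) f ` \<rho> = \<rho>" by (simp add: image_image)
    qed
    show "\<forall>\<rho>\<in>ptrees (f ` X) lab' r'. (`) f ` (`) ?g ` \<rho> = \<rho>"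
    proof
      fix \<rho> assume "\<rho> \<in> ptrees (f ` X) lab' r'"
      then have "(\<lambda>B. f ` ?g ` B) ` \<rho> = (\<lambda>B. B) ` \<rho>"
        by (intro image_cong refl image_inv_into_cancel[OF refl] partition_on_block_subset)
           (auto simp: ptrees_def)
      then show "(`) f ` (`) ?g ` \<rho> = \<rho>" by (simp add: image_image)
    qed
    show "(`) ((`) f) ` ptrees X lab r \<subseteq> ptrees (f ` X) lab' r'"
      by (rule image_subsetI) (rule ptrees_image[where f = f and lab = lab and r = r, OF fin _ mono lab rt])
    show "(`) ((`) ?g) ` ptrees (f ` X) lab' r' \<subseteq> ptrees X lab r"
    proof (rule image_subsetI)
      fix \<rho> assume \<rho>: "\<rho> \<in> ptrees (f ` X) lab' r'"
      have labg: "lab (?g x) = lab (?g y) \<longleftrightarrow> lab' x = lab' y" if "x \<in> f ` X" "y \<in> f ` X" for x y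
        using that by (elim imageE) (simp add: g lab)
      have rtg: "lab (?g x) = r \<longleftrightarrow> lab' x = r'" if "x \<in> f ` X" for x
        using that by (elim imageE) (simp add: g rt)
      have "(`) ?g ` \<rho> \<in> ptrees (?g ` f ` X) lab r"
        by (rule ptrees_image[where f = ?g and lab = lab' and r = r', OF _ \<rho> monog labg rtg]) (simp add: fin)
      then show "(`) ?g ` \<rho> \<in> ptrees X lab r" unfolding gX .
    qed
  qed
  then show ?thesis by (simp add: bij_betw_same_card)
qed

text \<open>A singleton block at a root point is a leaf: removing it costs one vertex and one edge.
  The root remains a vertex even if \<open>x\<close> was the only point carrying it.\<close>

lemma card_ptrees_singleton_block:
  assumes fin: "finite X" and x: "x \<in> X" and lab: "lab x = r"
  shows "card {\<rho> \<in> ptrees X lab r. {x} \<in> \<rho>} = card (ptrees (X - {x}) lab r)"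
proof -
  have labs: "insert r (lab ` (X - {x})) = insert r (lab ` X)" using lab x by auto
  have cX: "card X = Suc (card (X - {x}))" using fin x by (metis card_Suc_Diff1)
  have "bij_betw (\<lambda>\<rho>. \<rho> - {{x}}) {\<rho> \<in> ptrees X lab r. {x} \<in> \<rho>} (ptrees (X - {x}) lab r)"
  proof (rule bij_betw_byWitness[where f' = "insert {x}"])
    show "\<forall>\<rho>\<in>{\<rho> \<in> ptrees X lab r. {x} \<in> \<rho>}. insert {x} (\<rho> - {{x}}) = \<rho>" by blast
    show "\<forall>\<sigma>\<in>ptrees (X - {x}) lab r. insert {x} \<sigma> - {{x}} = \<sigma>"
      using partition_on_block_subset by (fastforce simp: ptrees_def)
    show "(\<lambda>\<rho>. \<rho> - {{x}}) ` {\<rho> \<in> ptrees X lab r. {x} \<in> \<rho>} \<subseteq> ptrees (X - {x}) lab r"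
    proof (rule image_subsetI)
      fix \<rho> assume "\<rho> \<in> {\<rho> \<in> ptrees X lab r. {x} \<in> \<rho>}"
      then have part: "partition_on X \<rho>" and nc: "noncross \<rho>" and root: "rooted X lab r \<rho>"
        and cnt: "card (insert r (lab ` X)) + card \<rho> = card X + 1" and x\<rho>: "{x} \<in> \<rho>"
        by (auto simp: ptrees_def)
      have "rooted (X - {x}) lab r (\<rho> - {{x}})"
        unfolding rooted_def
      proof (intro allI impI, rule ccontr)
        fix A assume A: "stable (X - {x}) lab (\<rho> - {{x}}) A" "A \<noteq> {}" and r: "r \<notin> lab ` A"
        have xA: "x \<notin> A" using stable_subset[OF A(1)] by blast
        have "stable X lab \<rho> A"
        proof (rule stableI)
          show "A \<subseteq> X" using stable_subset[OF A(1)] by blast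
        next
          fix B y z assume B: "B \<in> \<rho>" "y \<in> B" "z \<in> B" "y \<in> A"
          then have "B \<noteq> {x}" using xA by blast
          then show "z \<in> A" using stable_block[OF A(1), of B y z] B by blast
        next
          fix y z assume yz: "y \<in> A" "z \<in> X" "lab z = lab y"
          then have "z \<noteq> x" using lab r by force
          then show "z \<in> A" using stable_lab[OF A(1), of y z] yz by blast
        qed
        from rootedD[OF root this A(2)] r show False by blast
      qed
      moreover have "card \<rho> = Suc (card (\<rho> - {{x}}))"
        using finite_elements[OF fin part] x\<rho> by (metis card_Suc_Diff1)
      ultimately show "\<rho> - {{x}} \<in> ptrees (X - {x}) lab r"
        using partition_on_Diff_singleton[OF part x\<rho>] noncross_subset[OF nc, of "\<rho> - {{x}}"] cnt labs cX
        by (simp add: ptrees_def)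
    qed
    show "insert {x} ` ptrees (X - {x}) lab r \<subseteq> {\<rho> \<in> ptrees X lab r. {x} \<in> \<rho>}"
    proof (rule image_subsetI)
      fix \<sigma> assume "\<sigma> \<in> ptrees (X - {x}) lab r"
      then have part: "partition_on (X - {x}) \<sigma>" and nc: "noncross \<sigma>"
        and root: "rooted (X - {x}) lab r \<sigma>"
        and cnt: "card (insert r (lab ` (X - {x}))) + card \<sigma> = card (X - {x}) + 1"
        by (auto simp: ptrees_def)
      have "\<Union>\<sigma> = X - {x}" using partition_onD1[OF part] by simp
      then have x\<sigma>: "x \<notin> \<Union>\<sigma>" by simp
      have "partition_on X (insert {x} \<sigma>)"
        using partition_on_insert[of "{x}" \<sigma> X] part x x\<sigma> by (simp add: disjnt_def)
      moreover have "noncross (insert {x} \<sigma>)"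
        using nc unfolding noncross_def by fastforce
      moreover have "rooted X lab r (insert {x} \<sigma>)"
        unfolding rooted_def
      proof (intro allI impI, rule ccontr)
        fix A assume A: "stable X lab (insert {x} \<sigma>) A" "A \<noteq> {}" and r: "r \<notin> lab ` A"
        have xA: "x \<notin> A" using r lab by blast
        have "stable (X - {x}) lab \<sigma> A"
        proof (rule stableI)
          show "A \<subseteq> X - {x}" using stable_subset[OF A(1)] xA by blast
        next
          fix B y z assume "B \<in> \<sigma>" "y \<in> B" "z \<in> B" "y \<in> A"
          then show "z \<in> A" using stable_block[OF A(1), of B y z] by blast
        next
          fix y z assume "y \<in> A" "z \<in> X - {x}" "lab z = lab y"
          then show "z \<in> A" using stable_lab[OF A(1), of y z] by blast
        qed
        from rootedD[OF root this A(2)] r show False by blast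
      qed
      moreover have "card (insert {x} \<sigma>) = Suc (card \<sigma>)"
        using finite_elements[OF _ part] fin x\<sigma> by (intro card_insert_disjoint) auto
      ultimately show "insert {x} \<sigma> \<in> {\<rho> \<in> ptrees X lab r. {x} \<in> \<rho>}"
        using cnt labs cX by (simp add: ptrees_def)
    qed
  qed
  then show ?thesis by (rule bij_betw_same_card)
qed

text \<open>The situation when \<open>b\<close> is the next element after \<open>x\<close> in its
  block. The label \<open>s\<close> of \<open>b\<close> is the only one that the points of
  \<open>L\<close> can share with the rest, so \<open>L\<close> forms a tree of its own rooted at
  \<open>s\<close>. On the other side \<open>x\<close> is contracted: it is deleted, and
  \<open>lab'\<close> identifies \<open>s\<close> with \<open>r\<close>, as both labels were joined
  through the block of \<open>x\<close> and \<open>b\<close>.\<close>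

locale arc_split =
  fixes X L R :: "'a::linorder set" and lab lab' :: "'a \<Rightarrow> 'b" and r s :: 'b and x b :: 'a
  assumes fin: "finite X" and xX: "x \<in> X" and bX: "b \<in> X" and xb: "x < b"
    and labx: "lab x = r" and labb: "lab b = s" and sr: "s \<noteq> r"
    and L: "L = {y\<in>X. x < y \<and> y < b}" and R: "R = X - L - {x}"
    and Lr: "\<And>y. y \<in> L \<Longrightarrow> lab y \<noteq> r"
    and LR: "\<And>y z. \<lbrakk>y \<in> L; z \<in> R; lab y = lab z\<rbrakk> \<Longrightarrow> lab y = s"
    and lab': "lab' = (\<lambda>y. if lab y = s then r else lab y)"
begin

definition ins :: "'a set \<Rightarrow> 'a set" where
  "ins B = (if b \<in> B then insert x B else B)"

lemma sets: "x \<notin> L" "x \<notin> R" "b \<notin> L" "b \<in> R" "L \<inter> R = {}" "X = insert x (L \<union> R)" "L \<subseteq> X" "R \<subseteq> X"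
  "finite L" "finite R"
  using fin xX bX xb by (auto simp: L R)

lemma card_X: "card X = Suc (card L + card R)"
  using sets by (simp add: card_Un_disjoint)

text \<open>The label \<open>s\<close> is counted once, as root of the left part; on the right
  \<open>lab'\<close> has absorbed it into \<open>r\<close>. Together with \<open>card_X\<close> the
  tree equations balance: \<open>card L + 1\<close> and \<open>card R + 1\<close> vertices add up to
  \<open>card X + 1\<close>.\<close>

lemma card_labels:
  "card (insert r (lab ` X)) = card (insert s (lab ` L)) + card (insert r (lab' ` R))"
proof -
  have "lab' z \<noteq> s" for z using sr by (simp add: lab')
  moreover have "lab y \<noteq> lab' z" if "y \<in> L" "z \<in> R" for y z
    using Lr[OF that(1)] LR[OF that] by (auto simp: lab')
  ultimately have "insert s (lab ` L) \<inter> insert r (lab' ` R) = {}"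
    using sr Lr by blast
  moreover have "insert r (lab ` X) = insert s (lab ` L) \<union> insert r (lab' ` R)"
    using labx labb sets(4) unfolding sets(6) by (auto simp: lab' image_iff)
  ultimately show ?thesis
    using sets by (metis card_Un_disjoint finite_imageI finite_insert)
qed

text \<open>A stable subset of \<open>L\<close> avoiding \<open>s\<close> has no label in common
  with the points outside \<open>L\<close>, so it is stable in all of \<open>X\<close>, yet it
  cannot contain \<open>r\<close>.\<close>

lemma rooted_L:
  assumes root: "rooted X lab r \<rho>" and sub: "\<And>B. B \<in> \<rho> \<Longrightarrow> B \<subseteq> L \<or> B \<inter> L = {}"
  shows "rooted L lab s {B\<in>\<rho>. B \<subseteq> L}"
  unfolding rooted_def
proof (intro allI impI, rule ccontr)
  fix A assume A: "stable L lab {B\<in>\<rho>. B \<subseteq> L} A" "A \<noteq> {}" and s: "s \<notin> lab ` A"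
  have AL: "A \<subseteq> L" using stable_subset[OF A(1)] .
  have "stable X lab \<rho> A"
  proof (rule stableI)
    show "A \<subseteq> X" using AL sets by blast
  next
    fix B y z assume B: "B \<in> \<rho>" "y \<in> B" "z \<in> B" "y \<in> A"
    then have "B \<subseteq> L" using AL sub by blast
    then show "z \<in> A" using stable_block[OF A(1), of B y z] B by blast
  next
    fix y z assume yz: "y \<in> A" "z \<in> X" "lab z = lab y"
    have y: "y \<in> L" "lab y \<noteq> r" "lab y \<noteq> s" using yz AL Lr s by auto
    then have "z \<notin> R" "z \<noteq> x" using LR[of y z] yz labx by auto
    then have "z \<in> L" using yz sets(6) by blast
    then show "z \<in> A" using stable_lab[OF A(1), of y z] yz by blast
  qed
  from rootedD[OF root this A(2)] Lr AL show False by blast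
qed

lemma rooted_R:
  assumes part: "partition_on X \<rho>" and root: "rooted X lab r \<rho>"
    and B0: "B0 \<in> \<rho>" "x \<in> B0" "b \<in> B0"
    and sub: "\<And>B. B \<in> \<rho> \<Longrightarrow> B \<subseteq> L \<or> B \<inter> L = {}"
  shows "rooted R lab' r ((\<lambda>B. B - {x}) ` {B\<in>\<rho>. \<not> B \<subseteq> L})"
  unfolding rooted_def
proof (intro allI impI, rule ccontr)
  let ?Q = "(\<lambda>B. B - {x}) ` {B\<in>\<rho>. \<not> B \<subseteq> L}"
  fix A assume A: "stable R lab' ?Q A" "A \<noteq> {}" and r: "r \<notin> lab' ` A"
  have AR: "A \<subseteq> R" using stable_subset[OF A(1)] .
  have nrs: "lab y \<noteq> r" "lab y \<noteq> s" if "y \<in> A" for y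
    using r that by (force simp: lab')+
  have "stable X lab \<rho> A"
  proof (rule stableI)
    show "A \<subseteq> X" using AR sets by blast
  next
    fix B y z assume B: "B \<in> \<rho>" "y \<in> B" "z \<in> B" "y \<in> A"
    have yR: "y \<in> R" using B AR by blast
    have "B - {x} \<in> ?Q" using B(1,2) yR sets by blast
    note st = stable_block[OF A(1) this, of y]
    have "y \<noteq> x" using yR sets by blast
    \<comment> \<open>The block of \<open>x\<close> also contains \<open>b\<close>, whose label is
      merged into the root, and \<open>A\<close> avoids the root.\<close>
    have "x \<notin> B"
    proof
      assume "x \<in> B"
      then have "b \<in> B" using partition_on_same_block[OF part B(1) B0(1) _ B0(2)] B0(3) by blast
      then have "b \<in> A" using st[of b] B \<open>y \<noteq> x\<close> xb by blast
      then show False using nrs labb by blast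
    qed
    then show "z \<in> A" using st[of z] B \<open>y \<noteq> x\<close> by blast
  next
    fix y z assume yz: "y \<in> A" "z \<in> X" "lab z = lab y"
    have "z \<notin> L" using LR[of z y] yz AR nrs[of y] by auto
    moreover have "z \<noteq> x" using labx nrs[of y] yz by auto
    ultimately have "z \<in> R" using yz sets(6) by blast
    then show "z \<in> A" using stable_lab[OF A(1), of y z] yz by (simp add: lab')
  qed
  from rootedD[OF root this A(2)] nrs show False by blast
qed

text \<open>A stable set without \<open>r\<close> excludes \<open>x\<close>, hence \<open>b\<close>
  in the same block, hence every point labelled \<open>s\<close>. Its traces on \<open>L\<close> and
  \<open>R\<close> are then stable there and miss the respective roots, so both are empty.\<close>

lemma rooted_X:
  assumes P: "rooted L lab s P" and Q: "rooted R lab' r Q"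
    and BL: "\<And>B. B \<in> P \<Longrightarrow> B \<subseteq> L"
    and QR: "\<And>C. C \<in> Q \<Longrightarrow> C \<subseteq> R" and C0: "C0 \<in> Q" "b \<in> C0"
  shows "rooted X lab r (P \<union> ins ` Q)"
  unfolding rooted_def
proof (intro allI impI, rule ccontr)
  fix A assume A: "stable X lab (P \<union> ins ` Q) A" "A \<noteq> {}" and r: "r \<notin> lab ` A"
  have "x \<notin> A" using r labx by blast
  moreover have "ins C0 \<in> P \<union> ins ` Q" "x \<in> ins C0" "b \<in> ins C0" using C0 by (auto simp: ins_def)
  ultimately have "b \<notin> A" using stable_block[OF A(1), of "ins C0" b x] by blast
  then have s: "s \<notin> lab ` A" using stable_lab[OF A(1) _ bX] labb by force
  have "A \<inter> L = {}"
  proof (rule ccontr)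
    assume ne: "A \<inter> L \<noteq> {}"
    have "stable L lab P (A \<inter> L)"
    proof (rule stableI)
      fix B y z assume B: "B \<in> P" "y \<in> B" "z \<in> B" "y \<in> A \<inter> L"
      then have zA: "z \<in> A" using stable_block[OF A(1), of B y z] by blast
      show "z \<in> A \<inter> L" using zA BL[OF B(1)] B by blast
    next
      fix y z assume "y \<in> A \<inter> L" "z \<in> L" "lab z = lab y"
      then show "z \<in> A \<inter> L" using stable_lab[OF A(1), of y z] sets by blast
    qed blast
    from rootedD[OF P this ne] s show False by blast
  qed
  then have ne: "A \<inter> R \<noteq> {}" using A(2) \<open>x \<notin> A\<close> stable_subset[OF A(1)] sets(6) by blast
  have "stable R lab' Q (A \<inter> R)"
  proof (rule stableI)
    fix C y z assume C: "C \<in> Q" "y \<in> C" "z \<in> C" "y \<in> A \<inter> R"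
    then have "ins C \<in> P \<union> ins ` Q" "y \<in> ins C" "z \<in> ins C" by (auto simp: ins_def)
    then show "z \<in> A \<inter> R" using stable_block[OF A(1), of "ins C" y z] C QR by blast
  next
    fix y z assume yz: "y \<in> A \<inter> R" "z \<in> R" "lab' z = lab' y"
    have "lab y \<noteq> r" "lab y \<noteq> s" using yz r s by auto
    then have "lab z = lab y" using yz(3) by (auto simp: lab' split: if_splits)
    then show "z \<in> A \<inter> R" using stable_lab[OF A(1), of y z] yz sets by blast
  qed blast
  from rootedD[OF Q this ne] r s show False by (auto simp: lab' split: if_splits)
qed

text \<open>Since no point of \<open>R\<close> lies between \<open>x\<close> and \<open>b\<close>,
  the point \<open>x\<close> acts among the blocks of \<open>Q\<close> as a copy of
  \<open>b\<close>: the map \<open>\<phi>\<close> sends a crossing that involves \<open>x\<close> to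
  one inside \<open>Q\<close>. Blocks of \<open>P\<close> fill the convex gap \<open>L\<close> and
  cannot cross blocks outside it.\<close>

lemma noncross_ins:
  assumes P: "noncross P" "partition_on L P" and Q: "noncross Q" "partition_on R Q"
  shows "noncross (P \<union> ins ` Q)"
  unfolding noncross_def
proof (intro ballI impI)
  define \<phi> where "\<phi> y = (if y = x then b else y)" for y
  have PL: "V \<subseteq> L" if "V \<in> P" for V using partition_on_block_subset[OF P(2) that] .
  have QR: "C \<subseteq> R" if "C \<in> Q" for C using partition_on_block_subset[OF Q(2) that] .
  have \<phi>: "\<phi> y \<in> C" if "C \<in> Q" "y \<in> ins C" for y C
    using that QR[of C] sets by (auto simp: \<phi>_def ins_def split: if_splits)
  have insR: "ins C \<subseteq> insert x R" if "C \<in> Q" for C using QR[OF that] by (auto simp: ins_def)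
  have \<phi>_mono: "\<phi> y \<le> \<phi> z" if "y \<in> insert x R" "z \<in> insert x R" "y < z" for y z
    using that xb by (auto simp: \<phi>_def R L)
  have conv: "y \<in> L" if "u \<in> L" "w \<in> L" "u < y" "y < w" "y \<in> insert x R" for u w y
  proof -
    have "y \<in> X" using that(5) xX sets(8) by blast
    then show ?thesis using that(1-4) unfolding L by auto
  qed
  fix V W u v w z
  assume V: "V \<in> P \<union> ins ` Q" and W: "W \<in> P \<union> ins ` Q"
    and m: "u \<in> V" "v \<in> W" "w \<in> V" "z \<in> W" and ord: "u < v" "v < w" "w < z"
  consider "V \<in> P" "W \<in> P" | C where "V \<in> P" "C \<in> Q" "W = ins C" | C where "W \<in> P" "C \<in> Q" "V = ins C"
    | C D where "C \<in> Q" "D \<in> Q" "V = ins C" "W = ins D"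
    using V W by auto
  then show "V = W"
  proof cases
    case 1
    then show ?thesis using noncrossD[OF P(1)] m ord by blast
  next
    case 2
    then have "v \<in> insert x R" "u \<in> L" "w \<in> L" using m insR PL by blast+
    then show ?thesis using conv[of u w v] ord sets by blast
  next
    case 3
    then have "w \<in> insert x R" "v \<in> L" "z \<in> L" using m insR PL by blast+
    then show ?thesis using conv[of v z w] ord sets by blast
  next
    case 4
    have R': "u \<in> insert x R" "v \<in> insert x R" "w \<in> insert x R" "z \<in> insert x R"
      using 4 m insR by blast+
    have C: "\<phi> u \<in> C" "\<phi> w \<in> C" "\<phi> v \<in> D" "\<phi> z \<in> D" using 4 m \<phi> by blast+
    have "C = D"
    proof (rule ccontr)
      assume "C \<noteq> D"
      \<comment> \<open>As \<open>\<phi>\<close> is only weakly monotone, strictness comes from the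
        values lying alternately in two disjoint blocks.\<close>
      then have "y \<noteq> y'" if "y \<in> C" "y' \<in> D" for y y'
        using partition_on_same_block[OF Q(2) 4(1,2)] that by blast
      then have "\<phi> u < \<phi> v" "\<phi> v < \<phi> w" "\<phi> w < \<phi> z"
        using C \<phi>_mono R' ord by (metis order_le_less)+
      then show False using noncrossD[OF Q(1) 4(1,2)] C \<open>C \<noteq> D\<close> by blast
    qed
    then show ?thesis using 4 by simp
  qed
qed

lemma partition_on_ins:
  assumes P: "partition_on L P" and Q: "partition_on R Q"
  shows "partition_on X (P \<union> ins ` Q)"
proof (rule partition_onI)
  have QR: "C \<subseteq> R" if "C \<in> Q" for C using partition_on_block_subset[OF Q that] .
  have PL: "C \<subseteq> L" if "C \<in> P" for C using partition_on_block_subset[OF P that] .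
  obtain C0 where C0: "C0 \<in> Q" "b \<in> C0" using partition_on_block_ex[OF Q sets(4)] .
  have "\<Union>(ins ` Q) = insert x (\<Union>Q)"
    using C0 by (auto simp: ins_def split: if_splits)
  then show "\<Union>(P \<union> ins ` Q) = X"
    using partition_onD1[OF P] partition_onD1[OF Q] sets(6) by auto
  show "{} \<notin> P \<union> ins ` Q" using partition_onD3[OF P] partition_onD3[OF Q] by (auto simp: ins_def)
  have ins_disj: "ins C \<inter> ins D = {}" if "C \<in> Q" "D \<in> Q" "C \<noteq> D" for C D
  proof -
    have CD: "C \<inter> D = {}" using partition_on_same_block[OF Q that(1,2)] that(3) by blast
    moreover have "x \<notin> C" "x \<notin> D" using that QR sets by blast+
    ultimately show ?thesis by (auto simp: ins_def)
  qed
  fix V W assume V: "V \<in> P \<union> ins ` Q" and W: "W \<in> P \<union> ins ` Q" and "V \<noteq> W"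
  have insR: "ins C \<inter> L = {}" if "C \<in> Q" for C using QR[OF that] sets by (auto simp: ins_def)
  consider "V \<in> P" "W \<in> P" | C where "V \<in> P" "C \<in> Q" "W = ins C" | C where "W \<in> P" "C \<in> Q" "V = ins C"
    | C D where "C \<in> Q" "D \<in> Q" "V = ins C" "W = ins D"
    using V W by auto
  then have "V \<inter> W = {}"
  proof cases
    case 1
    then show ?thesis using partition_on_same_block[OF P 1] \<open>V \<noteq> W\<close> by blast
  next
    case 2
    then show ?thesis using insR PL by blast
  next
    case 3
    then show ?thesis using insR PL by blast
  next
    case 4
    then show ?thesis using ins_disj \<open>V \<noteq> W\<close> by blast
  qed
  then show "disjnt V W" by (simp add: disjnt_def)
qed

lemma ins_diff: "C \<subseteq> R \<Longrightarrow> ins C - {x} = C"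
  using sets by (auto simp: ins_def)

text \<open>Splitting and gluing \<open>x\<close> back to the block of \<open>b\<close> are mutually
  inverse. When splitting, only the sum of the two vertex counts is known at first;
  \<open>rooted_card_le\<close> bounds each of them from above, so both bounds are attained and both
  parts are trees.\<close>

lemma card_ptrees_arc:
  "card {\<rho> \<in> ptrees X lab r. \<exists>B\<in>\<rho>. x \<in> B \<and> b \<in> B \<and> B \<inter> L = {}} =
   card (ptrees L lab s) * card (ptrees R lab' r)"
proof -
  let ?T = "{\<rho> \<in> ptrees X lab r. \<exists>B\<in>\<rho>. x \<in> B \<and> b \<in> B \<and> B \<inter> L = {}}"
  let ?f = "\<lambda>\<rho>. ({B\<in>\<rho>. B \<subseteq> L}, (\<lambda>B. B - {x}) ` {B\<in>\<rho>. \<not> B \<subseteq> L})"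
  let ?g = "\<lambda>(P, Q). P \<union> ins ` Q"
  have gT: "?g (P, Q) \<in> ?T \<and> ?f (?g (P, Q)) = (P, Q)"
    if "P \<in> ptrees L lab s" "Q \<in> ptrees R lab' r" for P Q
  proof -
    have P: "partition_on L P" "noncross P" "rooted L lab s P"
        "card (insert s (lab ` L)) + card P = card L + 1"
      and Q: "partition_on R Q" "noncross Q" "rooted R lab' r Q"
        "card (insert r (lab' ` R)) + card Q = card R + 1"
      using that by (auto simp: ptrees_def)
    have QR: "C \<subseteq> R" if "C \<in> Q" for C using partition_on_block_subset[OF Q(1) that] .
    have PL: "C \<subseteq> L" if "C \<in> P" for C using partition_on_block_subset[OF P(1) that] .
    obtain C0 where C0: "C0 \<in> Q" "b \<in> C0" using partition_on_block_ex[OF Q(1) sets(4)] .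
    have nsub: "\<not> ins C \<subseteq> L" if "C \<in> Q" for C
    proof -
      have "C \<noteq> {}" using partition_onD3[OF Q(1)] that by blast
      then obtain y where "y \<in> C" by blast
      then have "y \<in> ins C" "y \<notin> L" using QR[OF that] sets(5) by (auto simp: ins_def)
      then show ?thesis by blast
    qed
    have inj: "inj_on ins Q" by (rule inj_on_inverseI[where g = "\<lambda>B. B - {x}"]) (simp add: ins_diff QR)
    have "P \<inter> ins ` Q = {}" using nsub PL by blast
    then have "card (P \<union> ins ` Q) = card P + card Q"
      using card_Un_disjoint[of P "ins ` Q"] card_image[OF inj]
        finite_elements[OF sets(9) P(1)] finite_elements[OF sets(10) Q(1)] by simp
    then have "P \<union> ins ` Q \<in> ptrees X lab r"
      using partition_on_ins[OF P(1) Q(1)] noncross_ins[OF P(2,1) Q(2,1)]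
        rooted_X[OF P(3) Q(3) PL QR C0] P(4) Q(4) card_labels card_X
      by (simp add: ptrees_def)
    moreover have "x \<in> ins C0 \<and> b \<in> ins C0 \<and> ins C0 \<inter> L = {}"
      using C0 QR[OF C0(1)] sets by (auto simp: ins_def)
    moreover have "{B \<in> P \<union> ins ` Q. B \<subseteq> L} = P" "{B \<in> P \<union> ins ` Q. \<not> B \<subseteq> L} = ins ` Q"
      using PL nsub by auto
    moreover have "(\<lambda>B. B - {x}) ` ins ` Q = Q"
      using ins_diff QR by (simp add: image_image cong: image_cong)
    ultimately show ?thesis using C0(1) by auto
  qed
  have fT: "?f \<rho> \<in> ptrees L lab s \<times> ptrees R lab' r \<and> ?g (?f \<rho>) = \<rho>" if \<rho>: "\<rho> \<in> ?T" for \<rho>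
  proof -
    from \<rho> obtain B0 where B0: "B0 \<in> \<rho>" "x \<in> B0" "b \<in> B0" "B0 \<inter> L = {}" by blast
    from \<rho> have part: "partition_on X \<rho>" and nc: "noncross \<rho>" and root: "rooted X lab r \<rho>"
      and cnt: "card (insert r (lab ` X)) + card \<rho> = card X + 1" by (auto simp: ptrees_def)
    have BX: "B \<subseteq> X" if "B \<in> \<rho>" for B using partition_on_block_subset[OF part that] .
    \<comment> \<open>A block with points both inside and outside the gap would cross
      \<open>B0\<close>.\<close>
    have sub: "B \<subseteq> L \<or> B \<inter> L = {}" if B: "B \<in> \<rho>" for B
    proof (rule ccontr)
      assume "\<not> ?thesis"
      then obtain y z where yz: "y \<in> B" "y \<in> L" "z \<in> B" "z \<notin> L" by blast
      then have "B \<noteq> B0" using B0 by blast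
      then have "z \<noteq> x" "z \<noteq> b" using partition_on_same_block[OF part B B0(1)] yz B0 by blast+
      then have "z < x \<or> b < z" using yz BX[OF B] by (auto simp: L)
      moreover have "x < y" "y < b" using yz by (auto simp: L)
      ultimately show False
        using noncrossD[OF nc B0(1) B, of x y b z] noncrossD[OF nc B B0(1), of z x y b] B0 yz \<open>B \<noteq> B0\<close>
        by blast
    qed
    define P Q where "P = {B\<in>\<rho>. B \<subseteq> L}" and "Q = (\<lambda>B. B - {x}) ` {B\<in>\<rho>. \<not> B \<subseteq> L}"
    have xb_iff: "x \<in> B \<longleftrightarrow> b \<in> B" if "B \<in> \<rho>" for B
      using partition_on_same_block[OF part that B0(1)] B0 by blast
    have ne: "B - {x} \<noteq> {}" if "B \<in> \<rho>" for B
      using xb_iff[OF that] partition_onD3[OF part] that xb by (cases "x \<in> B") auto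
    have insB: "ins (B - {x}) = B" if "B \<in> \<rho>" for B
      using xb_iff[OF that] xb by (auto simp: ins_def)
    have inj: "inj_on (\<lambda>B. B - {x}) {B\<in>\<rho>. \<not> B \<subseteq> L}"
      by (rule inj_on_inverseI[where g = ins]) (simp add: insB)
    have "?g (P, Q) = P \<union> {B\<in>\<rho>. \<not> B \<subseteq> L}"
    proof -
      have "ins ` Q = (\<lambda>B. B) ` {B\<in>\<rho>. \<not> B \<subseteq> L}"
        unfolding Q_def image_image by (intro image_cong refl insB) simp
      then show ?thesis by simp
    qed
    then have gf: "?g (P, Q) = \<rho>" by (auto simp: P_def)
    have Pp: "partition_on L P"
    proof (rule partition_onI)
      have "\<exists>B\<in>P. y \<in> B" if y: "y \<in> L" for y
      proof -
        obtain B where "B \<in> \<rho>" "y \<in> B" using partition_on_block_ex[OF part] y sets(7) by blast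
        then show ?thesis using sub[of B] y by (auto simp: P_def)
      qed
      then show "\<Union>P = L" by (auto simp: P_def)
      show "{} \<notin> P" using partition_onD3[OF part] by (auto simp: P_def)
      show "disjnt p q" if "p \<in> P" "q \<in> P" "p \<noteq> q" for p q
        using that partition_onD2[OF part] by (auto simp: P_def disjoint_def disjnt_def)
    qed
    have Qp: "partition_on R Q"
    proof (rule partition_onI)
      have "\<exists>B\<in>Q. y \<in> B" if y: "y \<in> R" for y
      proof -
        obtain B where "B \<in> \<rho>" "y \<in> B" using partition_on_block_ex[OF part] y sets(8) by blast
        moreover from this have "\<not> B \<subseteq> L" using y sets(5) by blast
        moreover have "y \<noteq> x" using y sets(2) by blast
        ultimately show ?thesis by (auto simp: Q_def)
      qed
      moreover have "B - {x} \<subseteq> R" if "B \<in> \<rho>" "\<not> B \<subseteq> L" for B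
        using sub[OF that(1)] that BX[OF that(1)] by (auto simp: R)
      ultimately show "\<Union>Q = R" by (auto simp: Q_def)
      show "{} \<notin> Q" using ne by (auto simp: Q_def)
      show "disjnt p q" if "p \<in> Q" "q \<in> Q" "p \<noteq> q" for p q
        using that partition_on_same_block[OF part] by (fastforce simp: Q_def disjnt_def)
    qed
    have Qnc: "noncross Q"
      unfolding noncross_def
    proof (intro ballI impI)
      fix V W u v w z
      assume VW: "V \<in> Q" "W \<in> Q" and m: "u \<in> V" "v \<in> W" "w \<in> V" "z \<in> W" and ord: "u < v" "v < w" "w < z"
      obtain B C where BC: "B \<in> \<rho>" "C \<in> \<rho>" "V = B - {x}" "W = C - {x}" using VW by (auto simp: Q_def)
      then have "B = C" using noncrossD[OF nc BC(1,2)] m ord by blast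
      then show "V = W" using BC by simp
    qed
    have Pr: "rooted L lab s P" unfolding P_def by (rule rooted_L[OF root sub])
    have Qr: "rooted R lab' r Q" unfolding Q_def by (rule rooted_R[OF part root B0(1-3) sub])
    have "card \<rho> = card P + card {B\<in>\<rho>. \<not> B \<subseteq> L}"
    proof -
      have "\<rho> = P \<union> {B\<in>\<rho>. \<not> B \<subseteq> L}" by (auto simp: P_def)
      then show ?thesis
        using card_Un_disjoint[of P "{B\<in>\<rho>. \<not> B \<subseteq> L}"] finite_elements[OF fin part]
        by (auto simp: P_def)
    qed
    then have "card \<rho> = card P + card Q" using card_image[OF inj] by (simp add: Q_def)
    then have "card (insert s (lab ` L)) + card P = card L + 1"
      "card (insert r (lab' ` R)) + card Q = card R + 1"
      using rooted_card_le[OF sets(9) Pp Pr] rooted_card_le[OF sets(10) Qp Qr] cnt card_labels card_X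
      by linarith+
    then have "P \<in> ptrees L lab s" "Q \<in> ptrees R lab' r"
      using Pp Qp Pr Qr Qnc noncross_subset[OF nc, of P] by (auto simp: ptrees_def P_def)
    then show ?thesis using gf by (simp add: P_def Q_def)
  qed
  have "bij_betw ?g (ptrees L lab s \<times> ptrees R lab' r) ?T"
    by (rule bij_betw_byWitness[where f' = ?f]) (use gT fT in auto)
  then have "card ?T = card (ptrees L lab s \<times> ptrees R lab' r)" by (rule bij_betw_same_card[symmetric])
  then show ?thesis by (simp add: card_cartesian_product)
qed

end

subsection \<open>Counting\<close>

text \<open>The coefficient of \<open>z\<^sup>M\<close> in \<open>S\<^sup>k\<close>, where \<open>S = 1 + l z S\<^sup>l\<close>.\<close>

function tcount :: "nat \<Rightarrow> nat \<Rightarrow> nat \<Rightarrow> nat" where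
  "tcount l k 0 = 1"
| "tcount l 0 (Suc M) = 0"
| "tcount l (Suc k) (Suc M) = tcount l k (Suc M) + l * tcount l (k + l) M"
  by pat_completeness auto
termination by (relation "inv_image (less_than <*lex*> less_than) (\<lambda>(l, k, M). (M, k))") auto

lemma tcount_0: "tcount l 0 M = (if M = 0 then 1 else 0)"
  by (cases M) auto

text \<open>On coefficients this is \<open>S^a * S^b = S^(a+b)\<close>, obtained here from the
  recursion alone.\<close>

lemma tcount_convolution:
  "(\<Sum>i\<le>M. tcount l a i * tcount l b (M - i)) = tcount l (a + b) M"
proof (induction l a M arbitrary: b rule: tcount.induct)
  case (2 l M)
  have "(\<Sum>i\<le>Suc M. tcount l 0 i * tcount l b (Suc M - i)) =
        (\<Sum>i\<le>Suc M. if i = 0 then tcount l b (Suc M) else 0)"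
    by (rule sum.cong) (auto simp: tcount_0)
  then show ?case by simp
next
  case (3 l k M)
  have "(\<Sum>i\<le>Suc M. tcount l (Suc k) i * tcount l b (Suc M - i)) =
    tcount l b (Suc M) + (\<Sum>i\<le>M. (tcount l k (Suc i) + l * tcount l (k + l) i) * tcount l b (M - i))"
    by (simp only: sum.atMost_Suc_shift) simp
  also have "\<dots> = (\<Sum>i\<le>Suc M. tcount l k i * tcount l b (Suc M - i))
      + l * (\<Sum>i\<le>M. tcount l (k + l) i * tcount l b (M - i))"
    by (simp only: sum.atMost_Suc_shift)
       (simp add: distrib_right sum.distrib sum_distrib_left mult.assoc)
  also have "\<dots> = tcount l (Suc k + b) (Suc M)"
    by (simp only: 3) (simp add: ac_simps)
  finally show ?case .
qed simp

text \<open>This is the Lagrange inversion coefficient, a Raney number times \<open>l ^ M\<close>,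
  with the denominator \<open>l * M + k\<close> cleared.\<close>

lemma tcount_closed_form:
  assumes "l \<ge> 1"
  shows "(l * M + k) * tcount l k M = l ^ M * k * ((l * M + k) choose M) \<or> (k = 0 \<and> M = 0)"
  using assms
proof (induction l k M rule: tcount.induct)
  case (3 l k M)
  \<comment> \<open>Raising \<open>k\<close> by \<open>l\<close> compensates lowering
    \<open>Suc M\<close> to \<open>M\<close>, so both recursive values involve binomials over the
    same \<open>?N\<close>.\<close>
  let ?N = "l * Suc M + k"
  have N: "?N > 0" using 3 by simp
  have M: "M \<le> ?N" using \<open>1 \<le> l\<close> by (metis Suc_leD le_add1 le_trans mult_le_mono1 nat_mult_1)
  have A: "?N * tcount l k (Suc M) = l ^ Suc M * k * (?N choose Suc M)"
    using 3 by auto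
  have B: "?N * tcount l (k + l) M = l ^ M * (k + l) * (?N choose M)"
    using 3 by (auto simp: algebra_simps)
  have C: "Suc M * (?N choose Suc M) + M * (?N choose M) = ?N * (?N choose M)"
    using binomial_absorb_comp[of ?N M] Suc_times_binomial_eq M
    by (metis add_diff_cancel_left' binomial_absorption diff_mult_distrib le_add_diff_inverse mult_le_mono1 add.commute)
  have "?N * ((l * Suc M + Suc k) * tcount l (Suc k) (Suc M)) =
    Suc ?N * (?N * tcount l k (Suc M) + l * (?N * tcount l (k + l) M))"
    by (simp add: algebra_simps)
  also have "\<dots> = l ^ Suc M * (Suc ?N * (k * (?N choose Suc M) + (k + l) * (?N choose M)))"
    unfolding A B by (simp add: algebra_simps)
  also have "Suc ?N * (k * (?N choose Suc M) + (k + l) * (?N choose M)) =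
     ?N * (Suc k * (Suc ?N choose Suc M))"
  proof -
    \<comment> \<open>Over the integers the claim is a polynomial consequence of \<open>C\<close>,
      with the two binomials treated as unknowns.\<close>
    have "int (Suc ?N * (k * (?N choose Suc M) + (k + l) * (?N choose M))) =
     int (?N * (Suc k * (Suc ?N choose Suc M)))"
    proof -
      define c d where "c = int (?N choose M)" and "d = int (?N choose Suc M)"
      have C': "(int M + 1) * d + int M * c = (int l * (int M + 1) + int k) * c"
        using arg_cong[OF C, of int] by (simp add: c_def d_def algebra_simps)
      have "(int l * (int M + 1) + int k + 1) * (int k * d + (int k + int l) * c) =
        (int l * (int M + 1) + int k) * ((int k + 1) * (c + d))"
        using C' by algebra
      then show ?thesis by (simp add: c_def d_def algebra_simps)
    qed
    then show ?thesis by (simp only: of_nat_eq_iff)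
  qed
  finally have "?N * ((l * Suc M + Suc k) * tcount l (Suc k) (Suc M)) =
    ?N * (l ^ Suc M * Suc k * (Suc ?N choose Suc M))" by (simp only: ac_simps)
  then have "(l * Suc M + Suc k) * tcount l (Suc k) (Suc M) =
    l ^ Suc M * Suc k * (Suc ?N choose Suc M)"
    using N by (simp only: mult_cancel1) auto
  then show ?case by simp
qed auto

section \<open>Trees over consecutive intervals of integer points\<close>

definition interval_label :: "nat \<Rightarrow> int \<Rightarrow> int" where
  "interval_label l y = (if y \<le> 0 then 0 else (y - 1) div int l + 1)"

text \<open>The last point of the first interval is \<open>0\<close>, so that the label function does not depend on \<open>k\<close>.\<close>

definition interval_trees :: "nat \<Rightarrow> nat \<Rightarrow> nat \<Rightarrow> int set set set" where
  "interval_trees l k M = ptrees {1 - int k..int (l * M)} (interval_label l) 0"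

lemma interval_label_pos: "y > 0 \<Longrightarrow> interval_label l y > 0"
  using pos_imp_zdiv_nonneg_iff[of "int l" "y - 1"] by (cases "l = 0") (auto simp: interval_label_def)

lemma interval_label_eq_0_iff: "interval_label l y = 0 \<longleftrightarrow> y \<le> 0"
  using interval_label_pos[of y l] by (cases "y \<le> 0") (auto simp: interval_label_def)

lemma interval_label_nonneg: "interval_label l y \<ge> 0"
  using interval_label_pos[of y l] by (cases "y > 0") (auto simp: interval_label_def)

lemma interval_label_mono: "y \<le> z \<Longrightarrow> interval_label l y \<le> interval_label l z"
  using interval_label_nonneg[of l z] by (cases "l = 0") (auto simp: interval_label_def zdiv_mono1)

lemma interval_trees_0:
  assumes "l \<ge> 1"
  shows "card (interval_trees l 0 M) = (if M = 0 then 1 else 0)"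
proof (cases "M = 0")
  case True
  then show ?thesis by (simp add: interval_trees_def ptrees_empty)
next
  case False
  then have "ptrees {1..int (l * M)} (interval_label l) 0 = {}"
    using assms by (intro ptrees_no_root) (auto simp: interval_label_eq_0_iff simp del: of_nat_mult)
  then show ?thesis using False by (simp add: interval_trees_def)
qed

text \<open>The part between \<open>x\<close> and \<open>b\<close> ends with the truncated interval of \<open>b\<close>, hence the reflection.\<close>

lemma card_left_part:
  assumes l: "l \<ge> 1"
  shows "card (ptrees {1..int q} (interval_label l) (interval_label l (int q + 1))) = card (interval_trees l (q mod l) (q div l))"
proof -
  define i p where "i = int (q div l)" and "p = int (q mod l)"
  have q: "int q = int l * i + p" by (simp add: i_def p_def flip: of_nat_mult of_nat_add)
  have p: "0 \<le> p" "p < int l" using l by (auto simp: p_def)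
  have s: "interval_label l (int q + 1) = i + 1" using p by (simp add: interval_label_def i_def zdiv_int)
  \<comment> \<open>The points \<open>1..q\<close> consist of \<open>i\<close> full intervals and
    \<open>p\<close> points sharing the interval of \<open>b = q + 1\<close>. The reflection takes
    the \<open>p\<close> nonpositive points to these last ones and reverses the full
    intervals.\<close>
  define f where "f y = int l * i + 1 - y" for y
  let ?Z = "{1 - p..int l * i}"
  have im: "f ` ?Z = {1..int q}"
    unfolding q f_def by (auto simp: image_iff intro!: bexI[where x = "int l * i + 1 - x" for x])
  have lab: "interval_label l (f y) = i + 1 - interval_label l y" if "y \<in> ?Z" for y
  proof (cases "y \<le> 0")
    case True
    have "(int l * i - y) div int l = i"
      using True that p by (intro int_div_pos_eq[of _ _ _ "- y"]) auto
    moreover have "int l * i \<ge> 0" by (simp add: i_def)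
    ultimately show ?thesis using True by (simp add: interval_label_def f_def)
  next
    case False
    define a where "a = (y - 1) div int l"
    have "(int l * i - y) div int l = i - 1 - a"
    proof (rule int_div_pos_eq[of _ _ _ "int l - 1 - (y - 1) mod int l"])
      have "y - 1 = int l * a + (y - 1) mod int l" by (simp add: a_def)
      then show "int l * i - y = int l * (i - 1 - a) + (int l - 1 - (y - 1) mod int l)"
        by (simp add: algebra_simps)
      show "0 \<le> int l - 1 - (y - 1) mod int l" "int l - 1 - (y - 1) mod int l < int l"
        using l pos_mod_bound[of "int l" "y - 1"] pos_mod_sign[of "int l" "y - 1"] by linarith+
    qed
    then show ?thesis using False that by (simp add: interval_label_def f_def a_def)
  qed
  have "card (ptrees (f ` ?Z) (interval_label l) (i + 1)) = card (ptrees ?Z (interval_label l) 0)"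
    by (rule card_ptrees_image[where f = f]) (auto simp: lab, auto simp: f_def)
  then show ?thesis unfolding im s by (simp add: interval_trees_def i_def p_def)
qed

lemma card_right_part:
  assumes l: "l \<ge> 1" and q: "q < l * M"
  shows "card (ptrees ({- int k..-1} \<union> {int q + 1..int (l * M)})
           (\<lambda>y. if interval_label l y = interval_label l (int q + 1) then 0 else interval_label l y) 0) =
         card (interval_trees l (k + l - q mod l) (M - 1 - q div l))"
proof -
  define i p where "i = int (q div l)" and "p = int (q mod l)"
  have q': "int q = int l * i + p" by (simp add: i_def p_def flip: of_nat_mult of_nat_add)
  have p: "0 \<le> p" "p < int l" using l by (auto simp: p_def)
  have s: "interval_label l (int q + 1) = i + 1" using p by (simp add: interval_label_def i_def zdiv_int)
  have iM: "q div l < M" using q l by (simp add: less_mult_imp_div_less mult.commute)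
  have i0: "i \<ge> 0" by (simp add: i_def)
  \<comment> \<open>The merged root interval has \<open>k\<close> points left of \<open>0\<close>
    and the \<open>l - p\<close> points of the interval of \<open>b\<close> from \<open>b\<close>
    on. The latter correspond to \<open>p - l + 1..0\<close>, which explains the threshold;
    everything above it is shifted by \<open>i + 1\<close> whole intervals.\<close>
  define f where "f y = (if y \<le> p - int l then y + int l - p - 1 else y + int l * (i + 1))" for y
  define lab' where "lab' y = (if interval_label l y = i + 1 then 0 else interval_label l y)" for y
  let ?Z = "{1 - (int k + int l - p)..int l * (int M - 1 - i)}"
  have li: "int l * (i + 1) > 0" using l i0 by simp
  have im: "f ` ?Z = {- int k..-1} \<union> {int q + 1..int (l * M)}"
  proof (intro equalityI subsetI)
    fix z assume "z \<in> f ` ?Z"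
    then show "z \<in> {- int k..-1} \<union> {int q + 1..int (l * M)}"
      unfolding q' using p by (auto simp: f_def algebra_simps split: if_splits)
  next
    fix z assume z: "z \<in> {- int k..-1} \<union> {int q + 1..int (l * M)}"
    show "z \<in> f ` ?Z"
    proof (cases "z < 0")
      case True
      have "int l * (int M - 1 - i) \<ge> 0" using iM by (simp add: i_def)
      then show ?thesis using True z p
        by (intro image_eqI[where x = "z - int l + p + 1"]) (auto simp: f_def)
    next
      case False
      then show ?thesis using z p unfolding q'
        by (intro image_eqI[where x = "z - int l * (i + 1)"]) (auto simp: f_def algebra_simps)
    qed
  qed
  have lab: "lab' (f y) = (if y \<le> 0 then 0 else interval_label l y + i + 1)" for y
  proof -
    consider "y \<le> p - int l" | "p - int l < y" "y \<le> 0" | "y > 0" by linarith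
    then show ?thesis
    proof cases
      case 1
      then show ?thesis using p i0 by (auto simp: lab'_def f_def interval_label_def)
    next
      case 2
      have "(int l * (i + 1) + y - 1) div int l = i"
        using 2 p by (intro int_div_pos_eq[of _ _ _ "int l + y - 1"]) (auto simp: algebra_simps)
      moreover have "y + int l * (i + 1) > 0" using 2 p i0 l
        by (smt (verit, best) mult_le_cancel_left1 of_nat_0_le_iff)
      ultimately show ?thesis using 2 by (simp add: lab'_def f_def interval_label_def algebra_simps)
    next
      case 3
      have "(y + int l * (i + 1) - 1) div int l = (y - 1) div int l + (i + 1)"
        using l div_mult_self2[of "int l" "y - 1" "i + 1"] by (simp add: algebra_simps)
      moreover have "(y - 1) div int l \<ge> 0" using 3 l by (simp add: pos_imp_zdiv_nonneg_iff)
      ultimately show ?thesis using 3 p li by (simp add: lab'_def f_def interval_label_def)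
    qed
  qed
  have "card (ptrees (f ` ?Z) lab' 0) = card (ptrees ?Z (interval_label l) 0)"
  proof (rule card_ptrees_image[where f = f])
    have "int l * (i + 1) \<ge> int l" using mult_left_mono[of 1 "i + 1" "int l"] i0 by simp
    then have "f x < f y" if "x < y" for x y
      using p that unfolding f_def by (smt (verit))
    then show "(\<forall>x\<in>?Z. \<forall>y\<in>?Z. x < y \<longrightarrow> f x < f y) \<or> (\<forall>x\<in>?Z. \<forall>y\<in>?Z. x < y \<longrightarrow> f y < f x)"
      by blast
    fix x y
    show "lab' (f x) = lab' (f y) \<longleftrightarrow> interval_label l x = interval_label l y"
      using i0 interval_label_nonneg[of l x] interval_label_nonneg[of l y] interval_label_eq_0_iff[of l x] interval_label_eq_0_iff[of l y] by (auto simp: lab)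
    show "lab' (f x) = 0 \<longleftrightarrow> interval_label l x = 0"
      using i0 interval_label_nonneg[of l x] interval_label_eq_0_iff[of l x] by (auto simp: lab)
  qed simp
  moreover have "?Z = {1 - int (k + l - q mod l)..int (l * (M - 1 - q div l))}"
    using iM p by (simp add: i_def p_def of_nat_diff)
  ultimately show ?thesis unfolding im s interval_trees_def lab'_def by simp
qed

text \<open>The last point of the first interval is \<open>x = 0\<close>, and
  \<open>q = b - 1\<close> counts the points strictly between \<open>x\<close> and \<open>b\<close>.
  They make up \<open>q div l\<close> full intervals and \<open>q mod l\<close> points of the
  interval of \<open>b\<close>; the other \<open>l - q mod l\<close> points of that interval join
  the \<open>k\<close> remaining root points.\<close>

lemma card_interval_trees_Suc:
  assumes l: "l \<ge> 1"
  shows "card (interval_trees l (Suc k) M) = card (interval_trees l k M) +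
    (\<Sum>q<l * M. card (interval_trees l (q mod l) (q div l)) *
               card (interval_trees l (k + l - q mod l) (M - 1 - q div l)))"
proof -
  let ?X = "{- int k..int (l * M)}"
  let ?T = "ptrees ?X (interval_label l) 0"
  let ?S = "{\<rho> \<in> ?T. {0} \<in> \<rho>}"
  define A where "A q = {\<rho> \<in> ?T. \<exists>B\<in>\<rho>. 0 \<in> B \<and> int q + 1 \<in> B \<and> B \<inter> {1..int q} = {}}" for q
  have part: "partition_on ?X \<rho>" if "\<rho> \<in> ?T" for \<rho> using that by (simp add: ptrees_def)
  have "?T = ?S \<union> (\<Union>q<l * M. A q)"
  proof (intro equalityI subsetI)
    fix \<rho> assume \<rho>: "\<rho> \<in> ?T"
    obtain B where B: "B \<in> \<rho>" "0 \<in> B" using partition_on_block_ex[OF part[OF \<rho>], of 0] by auto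
    have BX: "B \<subseteq> ?X" using partition_on_block_subset[OF part[OF \<rho>] B(1)] .
    show "\<rho> \<in> ?S \<union> (\<Union>q<l * M. A q)"
    proof (cases "\<exists>y\<in>B. y > 0")
      case False
      \<comment> \<open>All nonpositive points carry the root label, so a second one in the block of
        \<open>0\<close> would be a parallel edge.\<close>
      have "y = 0" if "y \<in> B" for y
        using ptrees_no_double_edge[OF _ \<rho> B(1) that B(2)] False that by (auto simp: interval_label_def)
      then have "B = {0}" using B by blast
      then show ?thesis using \<rho> B by blast
    next
      case True
      let ?b = "Min {y\<in>B. y > 0}"
      have fin: "finite {y\<in>B. y > 0}" using BX by (auto intro: finite_subset)
      have "{y\<in>B. y > 0} \<noteq> {}" using True by blast
      from Min_in[OF fin this] have b: "?b \<in> B" "?b > 0" by blast+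
      have "B \<inter> {1..?b - 1} = {}" using Min_le[OF fin] by fastforce
      then have "\<rho> \<in> A (nat (?b - 1))" using \<rho> B b by (auto simp: A_def)
      moreover have "nat (?b - 1) < l * M" using b BX by (auto simp: nat_less_iff)
      ultimately show ?thesis by blast
    qed
  qed (auto simp: A_def)
  moreover have "?S \<inter> (\<Union>q<l * M. A q) = {}"
  proof -
    have False if \<rho>: "\<rho> \<in> ?S" "\<rho> \<in> A q" for \<rho> q
    proof -
      obtain B where B: "B \<in> \<rho>" "0 \<in> B" "int q + 1 \<in> B" using \<rho> by (auto simp: A_def)
      have "\<rho> \<in> ?T" "{0} \<in> \<rho>" using \<rho> by auto
      then have "B = {0}" using partition_on_same_block[OF part B(1) _ B(2)] by blast
      then show False using B by simp
    qed
    then show ?thesis by blast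
  qed
  moreover have finT: "finite ?T" by (simp add: finite_ptrees)
  ultimately have "card ?T = card ?S + card (\<Union>q<l * M. A q)"
    by (metis (no_types, lifting) card_Un_disjoint finite_Un)
  also have "card (\<Union>q<l * M. A q) = (\<Sum>q<l * M. card (A q))"
  proof (rule card_UN_disjoint)
    show "\<forall>q\<in>{..<l * M}. finite (A q)" using finT by (auto simp: A_def)
    have False if q: "q < q'" and \<rho>: "\<rho> \<in> A q" "\<rho> \<in> A q'" for q q' \<rho>
    proof -
      obtain B where B: "B \<in> \<rho>" "0 \<in> B" "int q + 1 \<in> B" using \<rho> by (auto simp: A_def)
      obtain C where C: "C \<in> \<rho>" "0 \<in> C" "C \<inter> {1..int q'} = {}" using \<rho> by (auto simp: A_def)
      have "\<rho> \<in> ?T" using \<rho> by (simp add: A_def)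
      then have "B = C" using partition_on_same_block[OF part B(1) C(1) B(2) C(2)] by blast
      moreover have "int q + 1 \<in> {1..int q'}" using q by simp
      ultimately show False using B C by blast
    qed
    then show "\<forall>q\<in>{..<l * M}. \<forall>q'\<in>{..<l * M}. q \<noteq> q' \<longrightarrow> A q \<inter> A q' = {}"
      by (metis disjoint_iff linorder_neqE_nat)
  qed simp
  also have "(\<Sum>q<l * M. card (A q)) =
    (\<Sum>q<l * M. card (interval_trees l (q mod l) (q div l)) *
               card (interval_trees l (k + l - q mod l) (M - 1 - q div l)))"
  proof (rule sum.cong)
    fix q assume "q \<in> {..<l * M}"
    then have q: "q < l * M" by simp
    then have q'': "int q + 1 \<le> int (l * M)" by (simp flip: of_nat_Suc of_nat_mult)
    let ?s = "interval_label l (int q + 1)"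
    interpret arc_split ?X "{1..int q}" "{- int k..-1} \<union> {int q + 1..int (l * M)}" "interval_label l"
      "\<lambda>y. if interval_label l y = ?s then 0 else interval_label l y" 0 ?s 0 "int q + 1"
    proof
      show "{1..int q} = {y \<in> ?X. 0 < y \<and> y < int q + 1}" using q'' by auto
      show "{- int k..-1} \<union> {int q + 1..int (l * M)} = ?X - {1..int q} - {0}" using q'' by auto
      show "interval_label l y = ?s" if "y \<in> {1..int q}" "z \<in> {- int k..-1} \<union> {int q + 1..int (l * M)}"
        "interval_label l y = interval_label l z" for y z
      proof -
        have "y > 0" "y \<le> int q + 1" using that by auto
        then have "\<not> z \<le> 0" using interval_label_eq_0_iff[of l y] interval_label_eq_0_iff[of l z] that(3) by auto
        then have "int q + 1 \<le> z" using that by auto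
        then show ?thesis using interval_label_mono[of y "int q + 1" l] interval_label_mono[of "int q + 1" z l] that by auto
      qed
    qed (use q'' in \<open>auto simp: interval_label_eq_0_iff\<close>)
    show "card (A q) = card (interval_trees l (q mod l) (q div l)) *
               card (interval_trees l (k + l - q mod l) (M - 1 - q div l))"
      unfolding A_def card_ptrees_arc card_left_part[OF l] card_right_part[OF l q] ..
  qed simp
  also have "card ?S = card (interval_trees l k M)"
  proof -
    define f :: "int \<Rightarrow> int" where "f y = (if y \<le> 0 then y - 1 else y)" for y
    let ?Z = "{1 - int k..int (l * M)}"
    have im: "f ` ?Z = ?X - {0}"
    proof (intro equalityI subsetI)
      fix z assume "z \<in> ?X - {0}"
      then show "z \<in> f ` ?Z"
        by (intro image_eqI[where x = "if z < 0 then z + 1 else z"]) (auto simp: f_def simp del: of_nat_mult)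
    qed (auto simp: f_def simp del: of_nat_mult)
    have lab: "interval_label l (f y) = interval_label l y" for y by (simp add: f_def interval_label_def)
    have "card ?S = card (ptrees (?X - {0}) (interval_label l) 0)"
      by (rule card_ptrees_singleton_block) (auto simp: interval_label_def)
    also have "\<dots> = card (ptrees ?Z (interval_label l) 0)"
      unfolding im[symmetric] by (rule card_ptrees_image) (auto simp: lab, auto simp: f_def)
    finally show ?thesis by (simp add: interval_trees_def)
  qed
  finally show ?thesis by (simp add: interval_trees_def)
qed

lemma sum_mod_div:
  fixes f :: "nat \<Rightarrow> nat \<Rightarrow> nat"
  assumes "l \<ge> 1"
  shows "(\<Sum>q<l * n. f (q mod l) (q div l)) = (\<Sum>s<l. \<Sum>i<n. f s i)"
proof -
  have bound: "l * i + s < l * n" if "s < l" "i < n" for s i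
  proof -
    have "l * i + s < l * Suc i" using that by simp
    also have "\<dots> \<le> l * n" using that by (intro mult_le_mono2) simp
    finally show ?thesis .
  qed
  have div: "q div l < n" if "q < l * n" for q
    using that by (simp add: less_mult_imp_div_less mult.commute)
  have "(\<Sum>q<l * n. f (q mod l) (q div l)) = (\<Sum>(s, i)\<in>{..<l} \<times> {..<n}. f s i)"
    by (rule sum.reindex_bij_witness[where i = "\<lambda>(s, i). l * i + s" and j = "\<lambda>q. (q mod l, q div l)"])
       (use assms bound div in auto)
  then show ?thesis by (simp add: sum.cartesian_product)
qed

text \<open>Both factors in the sum over arcs have fewer than \<open>M\<close> further intervals,
  but their first interval may have more than \<open>k\<close> points; hence an outer induction on
  \<open>M\<close> for all \<open>k\<close> at once and an inner one on \<open>k\<close>.\<close>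

lemma card_interval_trees:
  assumes l: "l \<ge> 1"
  shows "card (interval_trees l k M) = tcount l k M"
proof (induction M arbitrary: k rule: less_induct)
  case (less M)
  show ?case
  proof (induction k)
    case 0
    then show ?case by (simp add: interval_trees_0[OF l] tcount_0)
  next
    case (Suc k)
    show ?case
    proof (cases M)
      case 0
      then show ?thesis using Suc by (simp add: card_interval_trees_Suc[OF l])
    next
      case (Suc M')
      have "(\<Sum>q<l * M. card (interval_trees l (q mod l) (q div l)) *
               card (interval_trees l (k + l - q mod l) (M - 1 - q div l))) =
            (\<Sum>q<l * M. tcount l (q mod l) (q div l) * tcount l (k + l - q mod l) (M - 1 - q div l))"
      proof (rule sum.cong[OF refl])
        fix q assume "q \<in> {..<l * M}"
        then have "q div l < M" using l by (simp add: less_mult_imp_div_less mult.commute)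
        then show "card (interval_trees l (q mod l) (q div l)) *
               card (interval_trees l (k + l - q mod l) (M - 1 - q div l)) =
          tcount l (q mod l) (q div l) * tcount l (k + l - q mod l) (M - 1 - q div l)"
          using less.IH by simp
      qed
      \<comment> \<open>For each residue \<open>s\<close> the inner sum is a convolution whose value
        is the same for all \<open>s\<close>.\<close>
      also have "\<dots> = (\<Sum>s<l. \<Sum>i<M. tcount l s i * tcount l (k + l - s) (M - 1 - i))"
        by (rule sum_mod_div[OF l])
      also have "\<dots> = (\<Sum>s<l. tcount l (k + l) M')"
      proof (rule sum.cong[OF refl])
        fix s assume "s \<in> {..<l}"
        then show "(\<Sum>i<M. tcount l s i * tcount l (k + l - s) (M - 1 - i)) = tcount l (k + l) M'"
          using tcount_convolution[of l s "k + l - s" M'] Suc by (simp add: lessThan_Suc_atMost)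
      qed
      finally show ?thesis
        using \<open>card (interval_trees l k M) = tcount l k M\<close> Suc by (simp add: card_interval_trees_Suc[OF l])
    qed
  qed
qed

subsection \<open>Distances in the Hasse diagram\<close>

lemma noncrossing_iff: "noncrossing \<rho> \<longleftrightarrow> noncross \<rho>"
  unfolding noncrossing_def noncross_def Ball_def Bex_def not_ex de_Morgan_conj not_imp
  by (rule iffI; intro allI impI; metis)

section \<open>Merging blocks and the covering relation\<close>

definition merge :: "'a set \<Rightarrow> 'a set \<Rightarrow> 'a set set \<Rightarrow> 'a set set" where
  "merge V W \<sigma> = insert (V \<union> W) (\<sigma> - {V, W})"

lemma partition_on_merge:
  assumes part: "partition_on X \<sigma>" and V: "V \<in> \<sigma>" and W: "W \<in> \<sigma>"
  shows "partition_on X (merge V W \<sigma>)"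
proof (rule partition_onI)
  show "\<Union>(merge V W \<sigma>) = X"
    unfolding partition_onD1[OF part] merge_def using V W by blast
  show "{} \<notin> merge V W \<sigma>"
    using partition_onD3[OF part] V by (auto simp: merge_def)
  have disj: "B \<inter> C = {}" if "B \<in> \<sigma>" "C \<in> \<sigma>" "B \<noteq> C" for B C
    using partition_onD2[OF part] that by (auto simp: disjoint_def)
  show "disjnt p q" if pq: "p \<in> merge V W \<sigma>" "q \<in> merge V W \<sigma>" "p \<noteq> q" for p q
  proof -
    consider "p = V \<union> W" "q \<in> \<sigma>" "q \<noteq> V" "q \<noteq> W" | "q = V \<union> W" "p \<in> \<sigma>" "p \<noteq> V" "p \<noteq> W"
      | "p \<in> \<sigma>" "q \<in> \<sigma>"
      using pq unfolding merge_def by blast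
    then show ?thesis
    proof cases
      case 1
      then show ?thesis using disj[of q V] disj[of q W] V W unfolding disjnt_def by blast
    next
      case 2
      then show ?thesis using disj[of p V] disj[of p W] V W unfolding disjnt_def by blast
    next
      case 3
      then show ?thesis using disj pq(3) by (simp add: disjnt_def)
    qed
  qed
qed

lemma card_merge:
  assumes fin: "finite X" and part: "partition_on X \<sigma>" and V: "V \<in> \<sigma>" and W: "W \<in> \<sigma>" and VW: "V \<noteq> W"
  shows "Suc (card (merge V W \<sigma>)) = card \<sigma>"
proof -
  have finp: "finite \<sigma>" using finite_elements[OF fin part] .
  have "V \<union> W \<notin> \<sigma>"
  proof
    assume *: "V \<union> W \<in> \<sigma>"
    obtain x y where "x \<in> V" "y \<in> W" using partition_onD3[OF part] V W by (metis ex_in_conv)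
    then have "V \<union> W = V" "V \<union> W = W"
      using partition_on_same_block[OF part * V, of x] partition_on_same_block[OF part * W, of y] by auto
    then show False using VW by simp
  qed
  then have "card (merge V W \<sigma>) = Suc (card (\<sigma> - {V, W}))"
    using finp by (simp add: merge_def)
  moreover have "card (\<sigma> - {V, W}) = card \<sigma> - 2"
    using V W VW finp by (simp add: card_Diff_subset)
  moreover have "card \<sigma> \<ge> 2"
    using card_mono[OF finp, of "{V, W}"] V W VW by simp
  ultimately show ?thesis by simp
qed

lemma refines_merge:
  assumes part: "partition_on X \<sigma>" and V: "V \<in> \<sigma>" and W: "W \<in> \<sigma>"
  shows "refines X \<sigma> (merge V W \<sigma>)"
  unfolding refines_def using part partition_on_merge[OF assms] by (auto simp: merge_def)

lemma merge_refines:
  assumes ref: "refines X \<sigma> \<tau>" and V: "V \<in> \<sigma>" and W: "W \<in> \<sigma>" and T: "T \<in> \<tau>" "V \<subseteq> T" "W \<subseteq> T"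
  shows "refines X (merge V W \<sigma>) \<tau>"
proof -
  have "\<exists>Y\<in>\<tau>. B \<subseteq> Y" if "B \<in> merge V W \<sigma>" for B
  proof (cases "B = V \<union> W")
    case True
    then show ?thesis using T by blast
  next
    case False
    then have "B \<in> \<sigma>" using that by (simp add: merge_def)
    then show ?thesis using ref by (simp add: refines_def)
  qed
  moreover have "partition_on X \<sigma>" "partition_on X \<tau>" using ref by (auto simp: refines_def)
  ultimately show ?thesis using partition_on_merge[OF _ V W] by (simp add: refines_def)
qed

text \<open>A block \<open>U\<close> crossing \<open>V \<union> W\<close> must lie in
  \<open>T\<close> too, as otherwise the block of \<open>\<tau>\<close> around \<open>U\<close>
  would cross \<open>T\<close>. Hence \<open>U\<close> has no point between the neighbours
  \<open>a\<close> and \<open>b\<close>. In a crossing that uses points of both \<open>V\<close> and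
  \<open>W\<close>, one of these points can then be replaced by \<open>a\<close> or
  \<open>b\<close>, which makes \<open>U\<close> cross \<open>V\<close> or \<open>W\<close>
  alone.\<close>

lemma noncross_merge:
  fixes \<sigma> :: "'a::linorder set set"
  assumes nc: "noncross \<sigma>" "noncross \<tau>" and ref: "refines X \<sigma> \<tau>"
    and V: "V \<in> \<sigma>" and W: "W \<in> \<sigma>" and T: "T \<in> \<tau>" "V \<subseteq> T" "W \<subseteq> T"
    and ab: "a \<in> V" "b \<in> W" "a < b" and adj: "\<And>t. t \<in> T \<Longrightarrow> t \<le> a \<or> b \<le> t"
  shows "noncross (merge V W \<sigma>)"
proof -
  have part: "partition_on X \<sigma>" using ref by (simp add: refines_def)
  note N = noncrossD[OF nc(1)]
  have sep: "False" if U: "U \<in> \<sigma>" "U \<noteq> V" "U \<noteq> W"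
    and cr: "(p \<in> V \<union> W \<and> q \<in> U \<and> p' \<in> V \<union> W \<and> q' \<in> U) \<or> (p \<in> U \<and> q \<in> V \<union> W \<and> p' \<in> U \<and> q' \<in> V \<union> W)"
    and ord: "p < q" "q < p'" "p' < q'" for U p q p' q'
  proof -
    obtain T' where T': "T' \<in> \<tau>" "U \<subseteq> T'" using ref U(1) by (auto simp: refines_def)
    have "T' = T"
      using cr
    proof
      assume "p \<in> V \<union> W \<and> q \<in> U \<and> p' \<in> V \<union> W \<and> q' \<in> U"
      then show ?thesis using noncrossD[OF nc(2) T(1) T'(1), of p q p' q'] T T' ord by blast
    next
      assume "p \<in> U \<and> q \<in> V \<union> W \<and> p' \<in> U \<and> q' \<in> V \<union> W"
      then show ?thesis using noncrossD[OF nc(2) T'(1) T(1), of p q p' q'] T T' ord by blast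
    qed
    have out: "t < a \<or> b < t" if "t \<in> U" for t
    proof -
      have "t \<noteq> a" "t \<noteq> b"
        using partition_on_same_block[OF part U(1) V that] partition_on_same_block[OF part U(1) W that]
          ab U by blast+
      moreover have "t \<le> a \<or> b \<le> t" using adj that T'(2) \<open>T' = T\<close> by blast
      ultimately show ?thesis by auto
    qed
    have NV: "\<not> (s \<in> V \<and> t \<in> U \<and> s' \<in> V \<and> t' \<in> U \<and> s < t \<and> t < s' \<and> s' < t')"
      "\<not> (s \<in> U \<and> t \<in> V \<and> s' \<in> U \<and> t' \<in> V \<and> s < t \<and> t < s' \<and> s' < t')"
      "\<not> (s \<in> W \<and> t \<in> U \<and> s' \<in> W \<and> t' \<in> U \<and> s < t \<and> t < s' \<and> s' < t')"
      "\<not> (s \<in> U \<and> t \<in> W \<and> s' \<in> U \<and> t' \<in> W \<and> s < t \<and> t < s' \<and> s' < t')" for s t s' t'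
      using N[OF V U(1)] N[OF U(1) V] N[OF W U(1)] N[OF U(1) W] U by blast+
    from cr show False
    proof
      assume m: "p \<in> V \<union> W \<and> q \<in> U \<and> p' \<in> V \<union> W \<and> q' \<in> U"
      then have o: "q < a \<or> b < q" "q' < a \<or> b < q'" using out by blast+
      consider "p \<in> V" "p' \<in> V" | "p \<in> W" "p' \<in> W" | "p \<in> V" "p' \<in> W" | "p \<in> W" "p' \<in> V"
        using m by blast
      then show False
      proof cases
        case 1 then show ?thesis using NV(1)[of p q p' q'] m ord by blast
      next
        case 2 then show ?thesis using NV(3)[of p q p' q'] m ord by blast
      next
        case 3
        then show ?thesis
          using NV(4)[of q p' q' b] NV(1)[of p q a q'] NV(3)[of b q p' q'] m o ord ab by (meson less_trans)
      next
        case 4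
        then show ?thesis
          using NV(2)[of q p' q' a] NV(3)[of p q b q'] NV(1)[of a q p' q'] m o ord ab by (meson less_trans)
      qed
    next
      assume m: "p \<in> U \<and> q \<in> V \<union> W \<and> p' \<in> U \<and> q' \<in> V \<union> W"
      then have o: "p < a \<or> b < p" "p' < a \<or> b < p'" using out by blast+
      consider "q \<in> V" "q' \<in> V" | "q \<in> W" "q' \<in> W" | "q \<in> V" "q' \<in> W" | "q \<in> W" "q' \<in> V"
        using m by blast
      then show False
      proof cases
        case 1 then show ?thesis using NV(2)[of p q p' q'] m ord by blast
      next
        case 2 then show ?thesis using NV(4)[of p q p' q'] m ord by blast
      next
        case 3
        then show ?thesis
          using NV(2)[of p q p' a] NV(4)[of p b p' q'] NV(1)[of a p q p'] m o ord ab by (meson less_trans)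
      next
        case 4
        then show ?thesis
          using NV(4)[of p q p' b] NV(2)[of p a p' q'] NV(3)[of b p q p'] m o ord ab by (meson less_trans)
      qed
    qed
  qed
  show ?thesis
    unfolding noncross_def
  proof (intro ballI impI)
    fix P Q p q p' q'
    assume PQ: "P \<in> merge V W \<sigma>" "Q \<in> merge V W \<sigma>"
      and m: "p \<in> P" "q \<in> Q" "p' \<in> P" "q' \<in> Q" and ord: "p < q" "q < p'" "p' < q'"
    consider "P = Q" | "P = V \<union> W" "Q \<in> \<sigma>" "Q \<noteq> V" "Q \<noteq> W" | "Q = V \<union> W" "P \<in> \<sigma>" "P \<noteq> V" "P \<noteq> W"
      | "P \<in> \<sigma>" "Q \<in> \<sigma>"
      using PQ by (auto simp: merge_def)
    then show "P = Q"
    proof cases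
      case 2
      then show ?thesis using sep[of Q p q p' q'] m ord by blast
    next
      case 3
      then show ?thesis using sep[of P p q p' q'] m ord by blast
    next
      case 4
      then show ?thesis using N m ord by blast
    qed
  qed
qed

text \<open>Pick a block \<open>T\<close> of \<open>\<tau>\<close> that is not in
  \<open>\<sigma>\<close>, the block \<open>V\<close> of its minimum, and the least \<open>b\<close>
  in \<open>T - V\<close>. The predecessor of \<open>b\<close> in \<open>T\<close> then lies in
  \<open>V\<close>, which gives the adjacent pair that \<open>noncross_merge\<close> asks for.
  Non-crossing is kept conditional because common coarsenings of walks may cross.\<close>

lemma refines_merge_step:
  fixes \<sigma> :: "'a::linorder set set"
  assumes fin: "finite X" and ref: "refines X \<sigma> \<tau>" and neq: "\<sigma> \<noteq> \<tau>"
  obtains V W where "V \<in> \<sigma>" "W \<in> \<sigma>" "V \<noteq> W" "refines X (merge V W \<sigma>) \<tau>"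
    "noncross \<sigma> \<Longrightarrow> noncross \<tau> \<Longrightarrow> noncross (merge V W \<sigma>)"
proof -
  have ps: "partition_on X \<sigma>" and pt: "partition_on X \<tau>" using ref by (auto simp: refines_def)
  have "\<not> \<tau> \<subseteq> \<sigma>"
  proof
    assume "\<tau> \<subseteq> \<sigma>"
    then have "refines X \<tau> \<sigma>" using ps pt by (auto simp: refines_def)
    then show False using refines_asym[OF ref] neq by blast
  qed
  then obtain T where T: "T \<in> \<tau>" "T \<notin> \<sigma>" by blast
  have TX: "T \<subseteq> X" using partition_on_block_subset[OF pt T(1)] .
  have finT: "finite T" using TX fin finite_subset by blast
  have T0: "T \<noteq> {}" using partition_onD3[OF pt] T(1) by blast
  have sub: "B \<subseteq> T" if B: "B \<in> \<sigma>" "y \<in> B" "y \<in> T" for B y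
  proof -
    obtain Y where "Y \<in> \<tau>" "B \<subseteq> Y" using ref B(1) by (auto simp: refines_def)
    then show ?thesis using partition_on_same_block[OF pt _ T(1), of Y y] B by blast
  qed
  have minT: "Min T \<in> T" using Min_in[OF finT T0] .
  then obtain V where V: "V \<in> \<sigma>" "Min T \<in> V" using partition_on_block_ex[OF ps] TX by blast
  have VT: "V \<subseteq> T" using sub V minT by blast
  have "T - V \<noteq> {}" using VT V(1) T(2) by (metis Diff_eq_empty_iff subset_antisym)
  with finT have b: "Min (T - V) \<in> T - V" by (intro Min_in) auto
  let ?b = "Min (T - V)"
  obtain W where W: "W \<in> \<sigma>" "?b \<in> W" using partition_on_block_ex[OF ps] TX b by blast
  have WT: "W \<subseteq> T" using sub W b by blast
  have VW: "V \<noteq> W" using W b by blast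
  have below: "t \<in> V" if "t \<in> T" "t < ?b" for t
    using Min_le[of "T - V" t] finT that by (meson DiffI finite_Diff leD)
  let ?S = "{t\<in>T. t < ?b}"
  have "Min T \<le> ?b" using Min_le[OF finT] b by blast
  moreover have "Min T \<noteq> ?b"
  proof
    assume "Min T = ?b"
    then show False using V(2) b by simp
  qed
  ultimately have "Min T \<in> ?S" using minT by simp
  then have a: "Max ?S \<in> ?S" using Max_in[of ?S] finT by fastforce
  have adj: "t \<le> Max ?S \<or> ?b \<le> t" if "t \<in> T" for t
    using Max_ge[of ?S t] finT that by force
  have aV: "Max ?S \<in> V" using a below by blast
  have ab: "Max ?S < ?b" using a by blast
  have "noncross (merge V W \<sigma>)" if "noncross \<sigma>" "noncross \<tau>"
    by (rule noncross_merge[OF that ref V(1) W(1) T(1) VT WT aV W(2) ab adj])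
  then show thesis using that[OF V(1) W(1) VW merge_refines[OF ref V(1) W(1) T(1) VT WT]] by blast
qed

lemma refines_card_le:
  fixes \<sigma> :: "'a::linorder set set"
  assumes fin: "finite X" and ref: "refines X \<sigma> \<tau>"
  shows "card \<tau> \<le> card \<sigma>"
  using ref
proof (induction "card \<sigma>" arbitrary: \<sigma> rule: less_induct)
  case less
  show ?case
  proof (cases "\<sigma> = \<tau>")
    case False
    obtain V W where VW: "V \<in> \<sigma>" "W \<in> \<sigma>" "V \<noteq> W" "refines X (merge V W \<sigma>) \<tau>"
      using refines_merge_step[OF fin less.prems False] .
    have "partition_on X \<sigma>" using less.prems by (simp add: refines_def)
    then have "Suc (card (merge V W \<sigma>)) = card \<sigma>" using card_merge[OF fin _ VW(1-3)] by blast
    then show ?thesis using less.hyps[of "merge V W \<sigma>"] VW(4) by simp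
  qed simp
qed

lemma refines_card_less:
  fixes \<sigma> :: "'a::linorder set set"
  assumes fin: "finite X" and ref: "refines X \<sigma> \<tau>" and neq: "\<sigma> \<noteq> \<tau>"
  shows "card \<tau> < card \<sigma>"
proof -
  obtain V W where VW: "V \<in> \<sigma>" "W \<in> \<sigma>" "V \<noteq> W" "refines X (merge V W \<sigma>) \<tau>"
    using refines_merge_step[OF fin ref neq] .
  have "partition_on X \<sigma>" using ref by (simp add: refines_def)
  then have "Suc (card (merge V W \<sigma>)) = card \<sigma>" using card_merge[OF fin _ VW(1-3)] by blast
  then show ?thesis using refines_card_le[OF fin VW(4)] by simp
qed

text \<open>An intermediate partition would need a number of blocks strictly between two consecutive
  numbers.\<close>

lemma NC_covers_merge:
  assumes \<sigma>: "\<sigma> \<in> NC n" and VW: "V \<in> \<sigma>" "W \<in> \<sigma>" "V \<noteq> W" and nc: "noncross (merge V W \<sigma>)"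
  shows "NC_covers n (merge V W \<sigma>) \<sigma>"
proof -
  have part: "partition_on {1..n} \<sigma>" using \<sigma> by (simp add: NC_def)
  have c: "Suc (card (merge V W \<sigma>)) = card \<sigma>" using card_merge[OF _ part VW] by simp
  have "merge V W \<sigma> \<in> NC n"
    using nc partition_on_merge[OF part VW(1,2)] by (simp add: NC_def noncrossing_iff)
  moreover have "\<sigma> \<noteq> merge V W \<sigma>" using c by auto
  moreover have False if "\<theta> \<noteq> \<sigma>" "\<theta> \<noteq> merge V W \<sigma>" "refines {1..n} \<sigma> \<theta>" "refines {1..n} \<theta> (merge V W \<sigma>)" for \<theta>
    using refines_card_less[OF _ that(3)] refines_card_less[OF _ that(4)] that(1,2) c by auto
  ultimately show ?thesis
    using \<sigma> refines_merge[OF part VW(1,2)] unfolding NC_covers_def by blast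
qed

text \<open>\<open>refines_merge_step\<close> provides a merger inside \<open>NC n\<close> that
  still refines \<open>\<rho>\<close>; under a covering it has to be \<open>\<rho>\<close>
  itself.\<close>

lemma NC_coversE:
  assumes "NC_covers n \<rho> \<pi>"
  obtains V W where "V \<in> \<pi>" "W \<in> \<pi>" "V \<noteq> W" "\<rho> = merge V W \<pi>"
proof -
  have cov: "\<pi> \<in> NC n" "\<rho> \<in> NC n" "refines {1..n} \<pi> \<rho>" "\<pi> \<noteq> \<rho>"
    and none: "\<And>\<sigma>. \<lbrakk>\<sigma> \<in> NC n; \<sigma> \<noteq> \<pi>; \<sigma> \<noteq> \<rho>; refines {1..n} \<pi> \<sigma>; refines {1..n} \<sigma> \<rho>\<rbrakk> \<Longrightarrow> False"
    using assms unfolding NC_covers_def by blast+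
  have part: "partition_on {1..n} \<pi>" using cov(1) by (simp add: NC_def)
  obtain V W where VW: "V \<in> \<pi>" "W \<in> \<pi>" "V \<noteq> W" "refines {1..n} (merge V W \<pi>) \<rho>"
    "noncross \<pi> \<Longrightarrow> noncross \<rho> \<Longrightarrow> noncross (merge V W \<pi>)"
    using refines_merge_step[OF _ cov(3,4)] by blast
  have "noncross (merge V W \<pi>)" using VW(5) cov(1,2) by (simp add: NC_def noncrossing_iff)
  then have "merge V W \<pi> \<in> NC n"
    using partition_on_merge[OF part VW(1,2)] by (simp add: NC_def noncrossing_iff)
  moreover have "merge V W \<pi> \<noteq> \<pi>" using card_merge[OF _ part VW(1-3)] by auto
  ultimately have "\<rho> = merge V W \<pi>"
    using none[of "merge V W \<pi>"] refines_merge[OF part VW(1,2)] VW(4) by blast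
  then show thesis using that VW by blast
qed

section \<open>Walks and their lengths\<close>

abbreviation hasse_walk :: "nat \<Rightarrow> nat set set \<Rightarrow> (nat set set \<times> nat set set) list \<Rightarrow> nat set set \<Rightarrow> bool" where
  "hasse_walk n \<equiv> pre_digraph.awalk (with_proj (hasse_diagram n))"

lemma hasse_walk_Nil: "hasse_walk n \<pi> [] \<rho> \<longleftrightarrow> \<pi> = \<rho> \<and> \<pi> \<in> NC n"
proof -
  interpret pair_graph "hasse_diagram n" by (rule pair_graph_hasse_diagram)
  show ?thesis unfolding awalk_Nil_iff by (auto simp: hasse_diagram_def)
qed

lemma hasse_walk_Cons:
  "hasse_walk n \<pi> (e # p) \<rho> \<longleftrightarrow>
     (\<exists>\<sigma>. e = (\<pi>, \<sigma>) \<and> (NC_covers n \<pi> \<sigma> \<or> NC_covers n \<sigma> \<pi>) \<and> hasse_walk n \<sigma> p \<rho>)"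
proof -
  interpret pair_graph "hasse_diagram n" by (rule pair_graph_hasse_diagram)
  show ?thesis unfolding awalk_Cons_iff by (cases e) (auto simp: hasse_diagram_def)
qed

lemma hasse_walk_append:
  assumes "hasse_walk n \<pi> p \<sigma>" "hasse_walk n \<sigma> q \<rho>"
  shows "hasse_walk n \<pi> (p @ q) \<rho>"
proof -
  interpret pair_graph "hasse_diagram n" by (rule pair_graph_hasse_diagram)
  show ?thesis using assms by (rule awalk_appendI)
qed

lemma hasse_walk_chain:
  assumes "\<sigma> \<in> NC n" "\<tau> \<in> NC n" "refines {1..n} \<sigma> \<tau>"
  shows "\<exists>p q. hasse_walk n \<sigma> p \<tau> \<and> hasse_walk n \<tau> q \<sigma> \<and>
           length p + card \<tau> = card \<sigma> \<and> length q + card \<tau> = card \<sigma>"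
  using assms
proof (induction "card \<sigma>" arbitrary: \<sigma> rule: less_induct)
  case less
  show ?case
  proof (cases "\<sigma> = \<tau>")
    case True
    then have "hasse_walk n \<sigma> [] \<tau>" "hasse_walk n \<tau> [] \<sigma>" using less.prems by (auto simp: hasse_walk_Nil)
    then show ?thesis using True by (intro exI[of _ "[]"]) simp
  next
    case False
    obtain V W where VW: "V \<in> \<sigma>" "W \<in> \<sigma>" "V \<noteq> W" "refines {1..n} (merge V W \<sigma>) \<tau>"
      "noncross \<sigma> \<Longrightarrow> noncross \<tau> \<Longrightarrow> noncross (merge V W \<sigma>)"
      using refines_merge_step[OF _ less.prems(3) False] by blast
    let ?m = "merge V W \<sigma>"
    have cov: "NC_covers n ?m \<sigma>"
      using NC_covers_merge[OF less.prems(1) VW(1-3)] VW(5) less.prems(1,2) by (simp add: NC_def noncrossing_iff)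
    have c: "Suc (card ?m) = card \<sigma>"
      using card_merge[OF _ _ VW(1-3)] less.prems(1) by (auto simp: NC_def)
    have m: "?m \<in> NC n" using cov by (simp add: NC_covers_def)
    obtain p q where pq: "hasse_walk n ?m p \<tau>" "hasse_walk n \<tau> q ?m"
      "length p + card \<tau> = card ?m" "length q + card \<tau> = card ?m"
      using less.hyps[OF _ m less.prems(2) VW(4)] c by auto
    have "hasse_walk n ?m [(?m, \<sigma>)] \<sigma>"
      using cov less.prems(1) by (simp add: hasse_walk_Cons hasse_walk_Nil)
    then have "hasse_walk n \<tau> (q @ [(?m, \<sigma>)]) \<sigma>" using hasse_walk_append[OF pq(2)] by blast
    moreover have "hasse_walk n \<sigma> ((\<sigma>, ?m) # p) \<tau>" using cov pq(1) by (simp add: hasse_walk_Cons)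
    ultimately show ?thesis using pq(3,4) c
      by (intro exI[of _ "(\<sigma>, ?m) # p"] exI[of _ "q @ [(?m, \<sigma>)]"]) simp
  qed
qed

lemma hasse_walk_common_coarsening:
  assumes "hasse_walk n \<pi> p \<rho>"
  shows "\<exists>\<tau>. refines {1..n} \<pi> \<tau> \<and> refines {1..n} \<rho> \<tau> \<and> card \<pi> + card \<rho> \<le> length p + 2 * card \<tau>"
  using assms
proof (induction p arbitrary: \<pi>)
  case Nil
  then have "\<pi> = \<rho>" "partition_on {1..n} \<rho>" by (auto simp: hasse_walk_Nil NC_def)
  then show ?case by (intro exI[of _ \<rho>]) (simp add: refines_refl)
next
  case (Cons e p)
  then obtain \<sigma> where \<sigma>: "NC_covers n \<pi> \<sigma> \<or> NC_covers n \<sigma> \<pi>" "hasse_walk n \<sigma> p \<rho>"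
    by (auto simp: hasse_walk_Cons)
  obtain \<tau> where \<tau>: "refines {1..n} \<sigma> \<tau>" "refines {1..n} \<rho> \<tau>"
    "card \<sigma> + card \<rho> \<le> length p + 2 * card \<tau>"
    using Cons.IH[OF \<sigma>(2)] by blast
  have ps: "partition_on {1..n} \<sigma>" and pt: "partition_on {1..n} \<tau>" using \<tau>(1) by (auto simp: refines_def)
  from \<sigma>(1) show ?case
  proof
    assume cov: "NC_covers n \<sigma> \<pi>"
    obtain V W where VW: "V \<in> \<pi>" "W \<in> \<pi>" "V \<noteq> W" "\<sigma> = merge V W \<pi>" by (rule NC_coversE[OF cov])
    have "refines {1..n} \<pi> \<sigma>" using cov by (simp add: NC_covers_def)
    moreover from this have "partition_on {1..n} \<pi>" by (simp add: refines_def)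
    then have "Suc (card \<sigma>) = card \<pi>" using card_merge[OF _ _ VW(1-3)] VW(4) by blast
    ultimately show ?thesis using refines_trans[OF _ \<tau>(1)] \<tau>(2,3)
      by (intro exI[of _ \<tau>]) auto
  next
    assume cov: "NC_covers n \<pi> \<sigma>"
    obtain V W where VW: "V \<in> \<sigma>" "W \<in> \<sigma>" "V \<noteq> W" "\<pi> = merge V W \<sigma>" by (rule NC_coversE[OF cov])
    have c: "Suc (card \<pi>) = card \<sigma>" using card_merge[OF _ ps VW(1-3)] VW(4) by simp
    obtain S T where ST: "S \<in> \<tau>" "V \<subseteq> S" "T \<in> \<tau>" "W \<subseteq> T"
      using \<tau>(1) VW(1,2) unfolding refines_def by meson
    show ?thesis
    proof (cases "S = T")
      case True
      then have "refines {1..n} \<pi> \<tau>" using merge_refines[OF \<tau>(1) VW(1,2) ST(1,2)] ST VW(4) by simp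
      then show ?thesis using \<tau>(2,3) c by (intro exI[of _ \<tau>]) auto
    next
      case False
      \<comment> \<open>This merger lowers \<open>2 * card \<tau>\<close> by two, while
        \<open>card \<pi>\<close> is one less than \<open>card \<sigma>\<close>; the extra step of
        the walk pays for the difference. The merged partition may well cross.\<close>
      have r: "refines {1..n} \<tau> (merge S T \<tau>)" using refines_merge[OF pt ST(1,3)] .
      have "S \<union> T \<in> merge S T \<tau>" by (simp add: merge_def)
      then have "refines {1..n} \<pi> (merge S T \<tau>)"
        using merge_refines[OF refines_trans[OF \<tau>(1) r] VW(1,2), of "S \<union> T"] ST VW(4) by blast
      moreover have "Suc (card (merge S T \<tau>)) = card \<tau>" using card_merge[OF _ pt ST(1,3) False] by simp
      ultimately show ?thesis using refines_trans[OF \<tau>(2) r] \<tau>(3) c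
        by (intro exI[of _ "merge S T \<tau>"]) auto
    qed
  qed
qed

lemma hasse_dist_le: "hasse_walk n \<pi> p \<rho> \<Longrightarrow> hasse_dist n \<pi> \<rho> \<le> ereal (real (length p))"
  unfolding hasse_dist_eq_INF by (intro INF_lower) simp

lemma one_block_NC: "n \<ge> 1 \<Longrightarrow> {{1..n}} \<in> NC n"
  by (auto simp: NC_def noncrossing_iff noncross_def intro: partition_on_space)

lemma singletons_NC: "(\<lambda>x. {x}) ` {1..n} \<in> NC n"
  unfolding NC_def noncrossing_iff noncross_def using partition_on_singletons[of "{1..n}"] by auto

text \<open>The routes through the one-block partition and through the singletons have lengths
  \<open>card \<pi> + card \<rho> - 2\<close> and \<open>2 * n - card \<pi> - card \<rho>\<close>.
  Their sum is \<open>2 * n - 2\<close>, so distance \<open>n - 1\<close> forces both to equal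
  \<open>n - 1\<close>. The second claim is confined to \<open>\<tau>\<close> in
  \<open>NC n\<close>, since a walk has to pass through \<open>\<tau>\<close>; the third assumes its
  bound for all \<open>\<tau>\<close>, since the coarsening extracted from a walk may cross.\<close>

lemma hasse_dist_max_iff:
  assumes n: "n \<ge> 1" and \<pi>: "\<pi> \<in> NC n" and \<rho>: "\<rho> \<in> NC n"
  shows "hasse_dist n \<pi> \<rho> = ereal (real n - 1) \<Longrightarrow> card \<pi> + card \<rho> = n + 1"
    and "\<lbrakk>hasse_dist n \<pi> \<rho> = ereal (real n - 1); \<tau> \<in> NC n; refines {1..n} \<pi> \<tau>; refines {1..n} \<rho> \<tau>\<rbrakk>
      \<Longrightarrow> card \<tau> \<le> 1"
    and "\<lbrakk>card \<pi> + card \<rho> = n + 1;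
      \<And>\<tau>. \<lbrakk>refines {1..n} \<pi> \<tau>; refines {1..n} \<rho> \<tau>\<rbrakk> \<Longrightarrow> card \<tau> \<le> 1\<rbrakk>
      \<Longrightarrow> hasse_dist n \<pi> \<rho> = ereal (real n - 1)"
proof -
  have pp: "partition_on {1..n} \<pi>" "partition_on {1..n} \<rho>" using \<pi> \<rho> by (auto simp: NC_def)
  have up: "\<exists>p. hasse_walk n \<pi> p \<rho> \<and> length p + 2 * card \<tau> = card \<pi> + card \<rho>"
    if \<tau>: "\<tau> \<in> NC n" "refines {1..n} \<pi> \<tau>" "refines {1..n} \<rho> \<tau>" for \<tau>
  proof -
    obtain p q where "hasse_walk n \<pi> p \<tau>" "length p + card \<tau> = card \<pi>"
      "hasse_walk n \<tau> q \<rho>" "length q + card \<tau> = card \<rho>"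
      using hasse_walk_chain[OF \<pi> \<tau>(1,2)] hasse_walk_chain[OF \<rho> \<tau>(1,3)] by blast
    then show ?thesis by (intro exI[of _ "p @ q"]) (auto intro: hasse_walk_append)
  qed
  let ?top = "{{1..n}}" and ?bot = "(\<lambda>x. {x}) ` {1..n}"
  have top: "refines {1..n} \<sigma> ?top" if "partition_on {1..n} \<sigma>" for \<sigma>
    using that one_block_NC[OF n] partition_on_block_subset[OF that] by (auto simp: refines_def NC_def)
  have bot: "refines {1..n} ?bot \<sigma>" if "partition_on {1..n} \<sigma>" for \<sigma>
    using that partition_on_singletons[of "{1..n}"] partition_onD1[OF that] by (auto simp: refines_def)
  obtain p where p: "hasse_walk n \<pi> p \<rho>" "length p + 2 = card \<pi> + card \<rho>"
    using up[OF one_block_NC[OF n] top[OF pp(1)] top[OF pp(2)]] by auto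
  have cb: "card ?bot = n" by (simp add: card_image)
  obtain q q' where "hasse_walk n \<pi> q ?bot" "length q + card \<pi> = n"
      "hasse_walk n ?bot q' \<rho>" "length q' + card \<rho> = n"
    using hasse_walk_chain[OF singletons_NC \<pi> bot[OF pp(1)]] hasse_walk_chain[OF singletons_NC \<rho> bot[OF pp(2)]] cb
    by auto
  then have q: "hasse_walk n \<pi> (q @ q') \<rho>" "length (q @ q') + card \<pi> + card \<rho> = 2 * n"
    by (auto intro: hasse_walk_append)
  {
    assume d: "hasse_dist n \<pi> \<rho> = ereal (real n - 1)"
    have len: "n \<le> length r + 1" if "hasse_walk n \<pi> r \<rho>" for r
      using hasse_dist_le[OF that] d by simp
    show sum: "card \<pi> + card \<rho> = n + 1" using len[OF p(1)] p(2) len[OF q(1)] q(2) by linarith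
    assume "\<tau> \<in> NC n" "refines {1..n} \<pi> \<tau>" "refines {1..n} \<rho> \<tau>"
    from up[OF this] obtain r where "hasse_walk n \<pi> r \<rho>" "length r + 2 * card \<tau> = card \<pi> + card \<rho>" by blast
    then show "card \<tau> \<le> 1" using len sum by fastforce
  }
  assume sum: "card \<pi> + card \<rho> = n + 1"
    and conn: "\<And>\<tau>. \<lbrakk>refines {1..n} \<pi> \<tau>; refines {1..n} \<rho> \<tau>\<rbrakk> \<Longrightarrow> card \<tau> \<le> 1"
  have "real n - 1 \<le> real (length r)" if "hasse_walk n \<pi> r \<rho>" for r
    using hasse_walk_common_coarsening[OF that] conn sum by fastforce
  then have "ereal (real n - 1) \<le> hasse_dist n \<pi> \<rho>"
    unfolding hasse_dist_eq_INF by (intro INF_greatest) simp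
  moreover have "hasse_dist n \<pi> \<rho> \<le> ereal (real n - 1)"
  proof -
    have "real (length p) = real n - 1" using p(2) sum by linarith
    then show ?thesis using hasse_dist_le[OF p(1)] by simp
  qed
  ultimately show "hasse_dist n \<pi> \<rho> = ereal (real n - 1)" by (rule antisym[rotated])
qed

subsection \<open>Meandric partners of interval partitions\<close>

text \<open>\<open>I\<close> is the first gap in the connected component \<open>A\<close> of \<open>1\<close>.\<close>

lemma stable_interval:
  fixes \<rho> :: "nat set set"
  assumes n: "n \<ge> 1" and part: "partition_on {1..n} \<rho>" and nc: "noncross \<rho>"
    and mono: "\<And>x y. \<lbrakk>x \<in> {1..n}; y \<in> {1..n}; x \<le> y\<rbrakk> \<Longrightarrow> lab x \<le> (lab y :: nat)"
    and unrooted: "\<not> rooted {1..n} lab (lab 1) \<rho>"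
  obtains I where "stable {1..n} lab \<rho> I" "I \<noteq> {}" "1 \<notin> I"
    "\<And>x y z. \<lbrakk>x \<in> I; z \<in> I; x \<le> y; y \<le> z\<rbrakk> \<Longrightarrow> y \<in> I"
proof -
  let ?N = "{1..n}"
  let ?P = "\<lambda>A. stable ?N lab \<rho> A \<and> 1 \<in> A"
  obtain A' where A': "stable ?N lab \<rho> A'" "A' \<noteq> {}" "lab 1 \<notin> lab ` A'"
    using unrooted unfolding rooted_def by blast
  have "stable ?N lab \<rho> (?N - A')"
  proof (rule stableI)
    fix B y z assume B: "B \<in> \<rho>" "y \<in> B" "z \<in> B" "y \<in> ?N - A'"
    then show "z \<in> ?N - A'"
      using stable_block[OF A'(1) B(1,3) _ B(2)] partition_on_block_subset[OF part B(1)] by blast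
  next
    fix y z assume "y \<in> ?N - A'" "z \<in> ?N" "lab z = lab y"
    then show "z \<in> ?N - A'" using stable_lab[OF A'(1), of z y] by auto
  qed blast
  then have P1: "?P (?N - A')" using n A'(3) by auto
  \<comment> \<open>A smallest stable set containing \<open>1\<close> serves as its connected
    component.\<close>
  define A where "A = arg_min card ?P"
  have PA: "?P A" and min: "\<And>D. ?P D \<Longrightarrow> card A \<le> card D"
    unfolding A_def using arg_min_nat_lemma[of ?P, OF P1] by blast+
  then have A: "stable ?N lab \<rho> A" "1 \<in> A" by blast+
  have AN: "A \<subseteq> ?N" using stable_subset[OF A(1)] .
  then have finA: "finite A" by (rule finite_subset) simp
  have "A' \<subseteq> ?N" using stable_subset[OF A'(1)] .
  then have "card (?N - A') < card ?N" using A'(2) by (intro psubset_card_mono) auto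
  then have "A \<noteq> ?N" using min[OF P1] by auto
  then have ne: "?N - A \<noteq> {}" using AN by blast
  define y0 where "y0 = Min (?N - A)"
  have y0: "y0 \<in> ?N - A" unfolding y0_def using ne by (intro Min_in) auto
  have y0_le: "y0 \<le> y" if "y \<in> ?N - A" for y unfolding y0_def using that by (intro Min_le) auto
  \<comment> \<open>These are the points from the first one missing in \<open>A\<close> up to the
    next element of \<open>A\<close>.\<close>
  define I where "I = {y\<in>?N - A. \<forall>a\<in>A. y0 < a \<longrightarrow> y < a}"
  have gap: "\<exists>a\<in>A. y < a \<and> a < z" if yz: "y \<in> I" "z \<in> ?N - A" "z \<notin> I" for y z
  proof -
    obtain a where a: "a \<in> A" "y0 < a" "a \<le> z" using yz(2,3) by (auto simp: I_def not_less)
    then have "y < a" using yz(1) by (simp add: I_def)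
    moreover have "a \<noteq> z" using a yz(2) by blast
    ultimately show ?thesis using a by auto
  qed
  have one_less: "1 < y" if "y \<in> ?N - A" for y
    using that A(2) by (metis DiffE atLeastAtMost_iff order_le_less)
  have "stable ?N lab \<rho> I"
  proof (rule stableI)
    show "I \<subseteq> ?N" by (auto simp: I_def)
  next
    fix B y z assume B: "B \<in> \<rho>" "y \<in> B" "z \<in> B" "y \<in> I"
    have yA: "y \<in> ?N - A" using B by (simp add: I_def)
    have BA: "t \<notin> A" if "t \<in> B" for t using stable_block[OF A(1) B(1) that _ B(2)] yA by blast
    have zA: "z \<in> ?N - A" using BA[OF B(3)] B(3) partition_on_block_subset[OF part B(1)] by blast
    show "z \<in> I"
    proof (rule ccontr)
      assume "z \<notin> I"
      then obtain a where a: "a \<in> A" "y < a" "a < z" using gap[OF B(4) zA] by blast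
      \<comment> \<open>If a block leaves the gap from \<open>y\<close> to \<open>z\<close>, the
        part of \<open>A\<close> below this arc is separated from the rest of \<open>A\<close>: by
        non-crossing for blocks, by monotone labels for intervals. So \<open>?D\<close> is still
        stable and contains \<open>1\<close> but not \<open>a\<close>, against the minimality of
        \<open>A\<close>.\<close>
      let ?D = "{c\<in>A. \<not> (y < c \<and> c < z)}"
      have out: "c < y \<or> z < c" if "c \<in> ?D" for c
      proof -
        have "c \<noteq> y" "c \<noteq> z" using that yA zA by blast+
        then show ?thesis using that by auto
      qed
      have "stable ?N lab \<rho> ?D"
      proof (rule stableI)
        show "?D \<subseteq> ?N" using AN by blast
      next
        fix C c d assume C: "C \<in> \<rho>" "c \<in> C" "d \<in> C" "c \<in> ?D"
        have dA: "d \<in> A" using stable_block[OF A(1) C(1,2) _ C(3)] C(4) by blast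
        have "\<not> (y < d \<and> d < z)"
        proof
          assume d: "y < d \<and> d < z"
          have "C = B"
            using out[OF C(4)] noncrossD[OF nc C(1) B(1), of c y d z] noncrossD[OF nc B(1) C(1), of y d z c]
              C(2,3) B(2,3) d by blast
          then show False using BA C(3) dA by blast
        qed
        then show "d \<in> ?D" using dA by blast
      next
        fix c d assume cd: "c \<in> ?D" "d \<in> ?N" "lab d = lab c"
        have dA: "d \<in> A" using stable_lab[OF A(1) _ cd(2,3)] cd(1) by blast
        have cN: "c \<in> ?N" using cd(1) AN by blast
        have "\<not> (y < d \<and> d < z)"
        proof
          assume d: "y < d \<and> d < z"
          have "lab y = lab c \<or> lab z = lab c"
            using out[OF cd(1)]
          proof
            assume "c < y"
            then have "lab c \<le> lab y" "lab y \<le> lab d"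
              using mono[of c y] mono[of y d] cN cd(2) yA d by auto
            then show ?thesis using cd(3) by simp
          next
            assume "z < c"
            then have "lab d \<le> lab z" "lab z \<le> lab c"
              using mono[of d z] mono[of z c] cN cd(2) zA d by auto
            then show ?thesis using cd(3) by simp
          qed
          then show False
            using stable_lab[OF A(1), of c y] stable_lab[OF A(1), of c z] cd(1) yA zA by blast
        qed
        then show "d \<in> ?D" using dA by blast
      qed
      moreover have "1 \<in> ?D" using A(2) one_less[OF yA] by simp
      ultimately have "card A \<le> card ?D" using min by blast
      moreover have "card ?D < card A" using a finA by (intro psubset_card_mono) auto
      ultimately show False by simp
    qed
  next
    fix y z assume yz: "y \<in> I" "z \<in> ?N" "lab z = lab y"
    have yA: "y \<in> ?N - A" using yz by (simp add: I_def)
    have zA: "z \<in> ?N - A" using stable_lab[OF A(1), of z y] yz yA by auto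
    show "z \<in> I"
    proof (rule ccontr)
      assume "z \<notin> I"
      then obtain a where a: "a \<in> A" "y < a" "a < z" using gap[OF yz(1) zA] by blast
      then have "lab y \<le> lab a" "lab a \<le> lab z" using mono[of y a] mono[of a z] yA zA AN by auto
      then have "lab y = lab a" using yz(3) by simp
      then show False using stable_lab[OF A(1) a(1), of y] yA by blast
    qed
  qed
  moreover have "I \<noteq> {}" using y0 by (auto simp: I_def)
  moreover have "1 \<notin> I" using A(2) by (simp add: I_def)
  moreover have "y \<in> I" if "x \<in> I" "z \<in> I" "x \<le> y" "y \<le> z" for x y z
  proof -
    have x: "x \<in> ?N - A" and z: "z \<in> ?N" using that by (auto simp: I_def)
    have "y \<notin> A"
    proof
      assume "y \<in> A"
      then have "y0 < y" using y0_le[OF x] that(3) y0 by (metis DiffE le_trans order_le_less)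
      then have "z < y" using that(2) \<open>y \<in> A\<close> by (simp add: I_def)
      then show False using that(4) by simp
    qed
    moreover have "y \<in> ?N" using x z that by auto
    moreover have "\<forall>a\<in>A. y0 < a \<longrightarrow> y < a" using that(2,4) by (auto simp: I_def)
    ultimately show ?thesis by (simp add: I_def)
  qed
  ultimately show thesis using that by blast
qed

section \<open>From the interval partition to labelled trees\<close>

definition point_block :: "nat \<Rightarrow> nat \<Rightarrow> nat" where
  "point_block l x = (x - 1) div l"

lemma interval_block_eq:
  assumes "l \<ge> 1" "j < m"
  shows "{j * l + 1..(j + 1) * l} = {x\<in>{1..l * m}. point_block l x = j}"
proof -
  have "Suc j * l \<le> m * l" using assms(2) by (intro mult_le_mono1) simp
  then have le: "j * l + l \<le> l * m" by (simp add: mult.commute)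
  have iff: "(x - 1) div l = j \<longleftrightarrow> j * l \<le> x - 1 \<and> x - 1 < j * l + l" for x
    using div_nat_eqI[of l j "x - 1"] div_times_less_eq_dividend[of "x - 1" l]
      dividend_less_div_times[of l "x - 1"] assms(1)
    by (auto simp: mult.commute)
  have sum: "(j + 1) * l = j * l + l" by simp
  have "x \<in> {j * l + 1..(j + 1) * l} \<longleftrightarrow> x \<in> {1..l * m} \<and> point_block l x = j" for x
    unfolding point_block_def iff atLeastAtMost_iff sum using le assms(1) by linarith
  then show ?thesis by blast
qed

lemma point_block_less: "\<lbrakk>l \<ge> 1; x \<in> {1..l * m}\<rbrakk> \<Longrightarrow> point_block l x < m"
  unfolding point_block_def by (intro less_mult_imp_div_less) (auto simp: mult.commute)

lemma interval_partition_eq: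
  assumes "l \<ge> 1"
  shows "interval_partition l m = (\<lambda>j. {x\<in>{1..l * m}. point_block l x = j}) ` {0..<m}"
  unfolding interval_partition_def using interval_block_eq[OF assms] by (intro image_cong) auto

lemma card_interval_partition:
  assumes l: "l \<ge> 1"
  shows "card (interval_partition l m) = m"
proof -
  have "inj_on (\<lambda>j. {j * l + 1..(j + 1) * l}) {0..<m}"
  proof (rule inj_onI)
    fix i j assume "{i * l + 1..(i + 1) * l} = {j * l + 1..(j + 1) * l}"
    then show "i = j" using l by (simp add: Icc_eq_Icc)
  qed
  then show ?thesis unfolding interval_partition_def by (simp add: card_image)
qed

lemma card_point_blocks:
  assumes l: "l \<ge> 1" and m: "m \<ge> 1"
  shows "card (insert 0 (point_block l ` {1..l * m})) = m"
proof -
  have "insert 0 (point_block l ` {1..l * m}) = {0..<m}"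
  proof (intro equalityI subsetI)
    fix j assume "j \<in> {0..<m}"
    then have "j < m" by simp
    have "j * l + 1 \<in> {j * l + 1..(j + 1) * l}" using l by simp
    then have "j * l + 1 \<in> {1..l * m}" "point_block l (j * l + 1) = j"
      unfolding interval_block_eq[OF l \<open>j < m\<close>] by auto
    then show "j \<in> insert 0 (point_block l ` {1..l * m})" by (metis image_eqI insertI2)
  qed (use point_block_less[OF l] m in auto)
  then show ?thesis by simp
qed

lemma interval_partition_refines_iff:
  assumes l: "l \<ge> 1" and part: "partition_on {1..l * m} \<tau>"
  shows "refines {1..l * m} (interval_partition l m) \<tau> \<longleftrightarrow>
    (\<forall>T\<in>\<tau>. \<forall>y\<in>T. \<forall>z\<in>{1..l * m}. point_block l z = point_block l y \<longrightarrow> z \<in> T)"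
proof
  assume ref: "refines {1..l * m} (interval_partition l m) \<tau>"
  show "\<forall>T\<in>\<tau>. \<forall>y\<in>T. \<forall>z\<in>{1..l * m}. point_block l z = point_block l y \<longrightarrow> z \<in> T"
  proof (intro ballI impI)
    fix T y z assume T: "T \<in> \<tau>" "y \<in> T" and z: "z \<in> {1..l * m}" "point_block l z = point_block l y"
    let ?B = "{x\<in>{1..l * m}. point_block l x = point_block l z}"
    have y: "y \<in> {1..l * m}" using partition_on_block_subset[OF part T(1)] T(2) by blast
    have "?B \<in> interval_partition l m"
      unfolding interval_partition_eq[OF l] using point_block_less[OF l z(1)] by auto
    then obtain Y where Y: "Y \<in> \<tau>" "?B \<subseteq> Y" using ref unfolding refines_def by blast
    then have "y \<in> Y" "z \<in> Y" using y z by auto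
    then show "z \<in> T" using partition_on_same_block[OF part Y(1) T(1)] T(2) by blast
  qed
next
  assume H: "\<forall>T\<in>\<tau>. \<forall>y\<in>T. \<forall>z\<in>{1..l * m}. point_block l z = point_block l y \<longrightarrow> z \<in> T"
  have part': "partition_on {1..l * m} (interval_partition l m)"
    using interval_partition_in_NC[OF l] by (simp add: NC_def)
  moreover have "\<exists>T\<in>\<tau>. B \<subseteq> T" if B: "B \<in> interval_partition l m" for B
  proof -
    have "B \<noteq> {}" using B partition_onD3[OF part'] by blast
    then obtain y where y: "y \<in> B" by blast
    then have "y \<in> {1..l * m}" using partition_on_block_subset[OF part' B] by blast
    then obtain T where T: "T \<in> \<tau>" "y \<in> T" using partition_on_block_ex[OF part] by blast
    have "B \<subseteq> T" using H T B y unfolding interval_partition_eq[OF l] by auto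
    then show ?thesis using T by blast
  qed
  ultimately show "refines {1..l * m} (interval_partition l m) \<tau>" using part by (simp add: refines_def)
qed

text \<open>If the graph is disconnected, the convex set from \<open>stable_interval\<close> and its
  complement form a coarsening in \<open>NC (l * m)\<close> with two blocks, which maximal distance
  excludes. Conversely, each block of any common coarsening is stable, so it contains a point of the
  first interval; as that interval lies in one block, there is only one.\<close>

lemma meandric_partners_eq:
  assumes l: "l \<ge> 1" and m: "m \<ge> 1"
  shows "meandric_partners (l * m) (interval_partition l m) = ptrees {1..l * m} (point_block l) 0"
proof -
  let ?n = "l * m" and ?\<pi> = "interval_partition l m"
  have n: "?n \<ge> 1" using l m by simp
  have pb1: "point_block l 1 = 0" by (simp add: point_block_def)
  have pbmono: "point_block l x \<le> point_block l y" if "x \<le> y" for x y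
    using that by (simp add: point_block_def div_le_mono)
  have "hasse_dist ?n ?\<pi> \<rho> = ereal (real ?n - 1) \<longleftrightarrow> card ?\<pi> + card \<rho> = ?n + 1 \<and> rooted {1..?n} (point_block l) 0 \<rho>"
    if \<rho>: "\<rho> \<in> NC ?n" for \<rho>
  proof -
    have part: "partition_on {1..?n} \<rho>" and nc: "noncross \<rho>"
      using \<rho> by (auto simp: NC_def noncrossing_iff)
    note D = hasse_dist_max_iff[OF n interval_partition_in_NC[OF l] \<rho>]
    show ?thesis
    proof
      assume d: "hasse_dist ?n ?\<pi> \<rho> = ereal (real ?n - 1)"
      have "rooted {1..?n} (point_block l) 0 \<rho>"
      proof (rule ccontr)
        assume "\<not> ?thesis"
        then have "\<not> rooted {1..?n} (point_block l) (point_block l 1) \<rho>" using pb1 by simp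
        then obtain I where I: "stable {1..?n} (point_block l) \<rho> I" "I \<noteq> {}" "1 \<notin> I"
          and conv: "\<And>x y z. \<lbrakk>x \<in> I; z \<in> I; x \<le> y; y \<le> z\<rbrakk> \<Longrightarrow> y \<in> I"
          using stable_interval[OF n part nc, of "point_block l"] pbmono by blast
        let ?J = "{1..?n} - I"
        have IN: "I \<subseteq> {1..?n}" using stable_subset[OF I(1)] .
        have J1: "1 \<in> ?J" using I(3) n by simp
        have pIJ: "partition_on {1..?n} {I, ?J}"
          using IN I(2) J1 by (intro partition_onI) (auto simp: disjnt_def)
        have "noncross {I, ?J}"
          unfolding noncross_def
        proof (intro ballI impI, rule ccontr)
          fix V W a b c e
          assume "V \<in> {I, ?J}" "W \<in> {I, ?J}" "a \<in> V" "b \<in> W" "c \<in> V" "e \<in> W" "a < b" "b < c" "c < e" "V \<noteq> W"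
          then show False using conv[of a c b] conv[of b e c] by auto
        qed
        then have "{I, ?J} \<in> NC ?n" using pIJ by (simp add: NC_def noncrossing_iff)
        moreover have "refines {1..?n} ?\<pi> {I, ?J}"
          unfolding interval_partition_refines_iff[OF l pIJ]
        proof (intro ballI impI)
          fix T y z assume "T \<in> {I, ?J}" "y \<in> T" "z \<in> {1..?n}" "point_block l z = point_block l y"
          then show "z \<in> T" using stable_lab[OF I(1), of y z] stable_lab[OF I(1), of z y] by auto
        qed
        moreover have "refines {1..?n} \<rho> {I, ?J}"
        proof -
          have "B \<subseteq> I \<or> B \<subseteq> ?J" if "B \<in> \<rho>" for B
          proof -
            have "B \<inter> I = {} \<or> B \<subseteq> I" using I(1) that by (simp add: stable_def)
            then show ?thesis using partition_on_block_subset[OF part that] by blast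
          qed
          then show ?thesis using part pIJ by (simp add: refines_def)
        qed
        ultimately have "card {I, ?J} \<le> 1" using D(2)[OF d] by blast
        moreover have "I \<noteq> ?J" using I(2) by blast
        ultimately show False by simp
      qed
      then show "card ?\<pi> + card \<rho> = ?n + 1 \<and> rooted {1..?n} (point_block l) 0 \<rho>" using D(1)[OF d] by blast
    next
      assume H: "card ?\<pi> + card \<rho> = ?n + 1 \<and> rooted {1..?n} (point_block l) 0 \<rho>"
      have "card \<tau> \<le> 1" if \<tau>: "refines {1..?n} ?\<pi> \<tau>" "refines {1..?n} \<rho> \<tau>" for \<tau>
      proof -
        have pt: "partition_on {1..?n} \<tau>" using \<tau>(1) by (simp add: refines_def)
        have root: "\<exists>y\<in>T. point_block l y = 0" if T: "T \<in> \<tau>" for T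
        proof (rule rootedD[OF conjunct2[OF H]])
          show "stable {1..?n} (point_block l) \<rho> T"
          proof (rule stableI)
            show "T \<subseteq> {1..?n}" using partition_on_block_subset[OF pt T] .
          next
            fix B y z assume B: "B \<in> \<rho>" "y \<in> B" "z \<in> B" "y \<in> T"
            then obtain Y where "Y \<in> \<tau>" "B \<subseteq> Y" using \<tau>(2) unfolding refines_def by blast
            then show "z \<in> T" using partition_on_same_block[OF pt _ T, of Y y] B by blast
          next
            fix y z assume "y \<in> T" "z \<in> {1..?n}" "point_block l z = point_block l y"
            then show "z \<in> T" using \<tau>(1) T unfolding interval_partition_refines_iff[OF l pt] by blast
          qed
          show "T \<noteq> {}" using partition_onD3[OF pt] T by blast
        qed
        have eq: "S = T" if S: "S \<in> \<tau>" and T: "T \<in> \<tau>" for S T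
        proof -
          obtain y z where "y \<in> S" "point_block l y = 0" "z \<in> T" "point_block l z = 0"
            using root[OF S] root[OF T] by blast
          moreover from this have "y \<in> {1..?n}" using partition_on_block_subset[OF pt S] by blast
          ultimately have "y \<in> T"
            using \<tau>(1) T unfolding interval_partition_refines_iff[OF l pt] by simp
          then show ?thesis using partition_on_same_block[OF pt S T \<open>y \<in> S\<close>] by blast
        qed
        then show ?thesis
          using finite_elements[OF _ pt] by (simp add: card_le_Suc0_iff_eq)
      qed
      then show "hasse_dist ?n ?\<pi> \<rho> = ereal (real ?n - 1)" using D(3) H by blast
    qed
  qed
  then show ?thesis
    unfolding meandric_partners_def ptrees_def card_point_blocks[OF l m] card_interval_partition[OF l]
    by (auto simp: NC_def noncrossing_iff)
qed

text \<open>Shifting by \<open>l\<close> puts the end of the first interval at \<open>0\<close>;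
  this interval is the root, and \<open>m - 1\<close> intervals remain.\<close>

lemma card_ptrees_point_block:
  assumes l: "l \<ge> 1" and m: "m \<ge> 1"
  shows "card (ptrees {1..l * m} (point_block l) 0) = card (interval_trees l l (m - 1))"
proof -
  let ?f = "\<lambda>x. int x - int l"
  have "int (l * (m - 1)) = int (l * m) - int l" using m by (simp add: of_nat_diff algebra_simps)
  then have im: "?f ` {1..l * m} = {1 - int l..int (l * (m - 1))}"
  proof (intro equalityI subsetI)
    fix y assume "y \<in> {1 - int l..int (l * (m - 1))}"
    with \<open>int (l * (m - 1)) = int (l * m) - int l\<close> show "y \<in> ?f ` {1..l * m}"
      by (intro image_eqI[of _ _ "nat (y + int l)"])
         (auto simp: le_nat_iff nat_le_iff simp del: of_nat_mult)
  qed (auto simp del: of_nat_mult)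
  have lab: "interval_label l (?f x) = int (point_block l x)" if "x \<in> {1..l * m}" for x
  proof (cases "x \<le> l")
    case True
    then have "x - 1 < l" using that by auto
    then show ?thesis using True by (simp add: interval_label_def point_block_def)
  next
    case False
    have "int ((x - 1) div l) = (int x - int l - 1 + int l) div int l"
      using that by (simp add: zdiv_int of_nat_diff)
    also have "\<dots> = (int x - int l - 1) div int l + 1" using l by (intro div_add_self2) simp
    finally show ?thesis using False by (simp add: interval_label_def point_block_def)
  qed
  have "card (ptrees (?f ` {1..l * m}) (interval_label l) 0) = card (ptrees {1..l * m} (point_block l) 0)"
    by (rule card_ptrees_image[where f = ?f]) (auto simp: lab)
  then show ?thesis unfolding im interval_trees_def by (rule sym)
qed

theorem proposition1p6:
  fixes l m :: nat
  assumes "l \<ge> 1" and "m \<ge> 1"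
  shows "real (card (meandric_partners (l * m) (interval_partition l m)))
           = FCat l m * real l ^ (m - 1)"
proof -
  let ?c = "card (meandric_partners (l * m) (interval_partition l m))"
  have c: "?c = tcount l l (m - 1)"
    by (simp only: meandric_partners_eq[OF assms] card_ptrees_point_block[OF assms] card_interval_trees[OF assms(1)])
  have lm: "l * (m - 1) + l = l * m" using assms by (cases m) auto
  \<comment> \<open>Here \<open>k = l\<close> and \<open>M = m - 1\<close>, so the denominator is
    \<open>l * m\<close> and a factor \<open>l\<close> cancels.\<close>
  have "(l * (m - 1) + l) * tcount l l (m - 1) = l ^ (m - 1) * l * ((l * (m - 1) + l) choose (m - 1))"
    using tcount_closed_form[OF assms(1), of "m - 1" l] assms(1) by (elim disjE) simp_all
  then have "l * (m * ?c) = l * (l ^ (m - 1) * ((l * m) choose (m - 1)))"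
    unfolding lm c by (simp only: ac_simps)
  then have A: "m * ?c = l ^ (m - 1) * ((l * m) choose (m - 1))" using assms by simp
  have mle: "m \<le> l * m" using assms by simp
  \<comment> \<open>This trades the factor \<open>1 / m\<close> and the lower index
    \<open>m - 1\<close> for the denominator \<open>(l - 1) * m + 1\<close> and the lower index
    \<open>m\<close> of \<open>FCat\<close>.\<close>
  have B: "m * ((l * m) choose m) = (l * m - m + 1) * ((l * m) choose (m - 1))"
    using binomial_absorb_comp[of "l * m" "m - 1"] binomial_absorption[of "m - 1" "l * m"] assms mle
    by (simp add: Suc_diff_le)
  have D: "real (l * m - m + 1) = (real l - 1) * real m + 1"
    using mle by (simp add: of_nat_diff algebra_simps)
  have "real m * real ?c * real (l * m - m + 1) =
    real l ^ (m - 1) * (real (l * m - m + 1) * real ((l * m) choose (m - 1)))"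
    using arg_cong[OF A, of real] by (simp add: ac_simps)
  also have "\<dots> = real m * (real l ^ (m - 1) * real ((l * m) choose m))"
    unfolding of_nat_mult[symmetric] B[symmetric] by (simp add: ac_simps)
  finally have "real ?c * real (l * m - m + 1) = real l ^ (m - 1) * real ((l * m) choose m)"
    using assms(2) by simp
  then have "real ?c = real ((l * m) choose m) * real l ^ (m - 1) / real (l * m - m + 1)"
    by (simp add: field_simps)
  then show ?thesis unfolding D FCat_def by (simp add: field_simps)
qed

end
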